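(* Let $n\ge 2$ and let $M_0,\ldots,M_n$ be non-trivial, affinely dominated $n$-variable operator means on $B(\mathcal H)_+$. Suppose that either all of them are arithmetic, or at most one of them is not strictly concave. Then there exists a unique probability vector $(p_0,\ldots,p_n)\in(0,1)^{n+1}$ such that, for any $A^{(0)},\ldots,A^{(n)}\in B(\mathcal H)_+$, the sequences $A_m^{(0)},\ldots,A_m^{(n)}$ ($m\ge0$) defined by $A_0^{(k)}=A^{(k)}$ and $$A_{m+1}^{(k)}=M_k\bigl(A_m^{(k+1)},A_m^{(k+2)},\ldots,A_m^{(k+n)}\bigr),\qquad k=0,1,\ldots,n$$ (upper indices taken modulo $n+1$), converge weakly (in the weak operator topology) to a common limit $S$ as $m\to\infty$, and $$\sum_{k=0}^n p_kA_m^{(k)}\downarrow S .$$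
   Context: $B(\mathcal H)_+$ is the set of positive (semidefinite) bounded operators on a Hilbert space $\mathcal H$. $A_m\downarrow A$ means that $(A_m)$ is decreasing and converges strongly to $A$. An $n$-variable operator mean is a map $M:(B(\mathcal H)_+)^n\to B(\mathcal H)_+$ satisfying: (I) monotonicity: $A_j\le B_j$ for all $j$ implies $M(A_1,\ldots,A_n)\le M(B_1,\ldots,B_n)$; (II) transformer inequality: $S\,M(A_1,\ldots,A_n)\,S\le M(SA_1S,\ldots,SA_nS)$ for all $S\in B(\mathcal H)_+$; (III) downward continuity: if $A_{jk}\downarrow A_j$ as $k\to\infty$ for each $j$, then $M(A_{1k},\ldots,A_{nk})\downarrow M(A_1,\ldots,A_n)$; (IV) $M(I,\ldots,I)=I$. For $n=2$ these are the Kubo–Ando operator means. Standing convention: the Kubo–Ando correspondence is in force for $\mathcal H$, i.e. every two-variable operator mean $\sigma$ on $B(\mathcal H)_+$ (in particular $(A,B)\mapsto M(A,B,\ldots,B)$, and likewise with $A$ in any other single slot) has the form $A\sigma B=A^{1/2}f(A^{-1/2}BA^{-1/2})A^{1/2}$ for $A>0$ (positive invertible), $B\ge0$, with $f$ a positive operator monotone function on $(0,\infty)$, $f(1)=1$; this holds for instance whenever $\mathcal H$ is infinite-dimensional. $M$ is trivial if for some $i$ one has $M(A_1,\ldots,A_n)=A_i$ for all $A_1,\ldots,A_n$; otherwise it is non-trivial. $M$ is arithmetic if there is a probability vector $(r_k)$ with $M(A_1,\ldots,A_n)=\sum_k r_kA_k$ for all positive operators $A_k$. $M$ is affinely dominated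 if there is a probability vector $(r_k)\in(0,1)^n$ with $M(A_1,\ldots,A_n)\le\sum_k r_kA_k$ for all positive operators $A_k$. An affinely dominated $M$ (with such $(r_k)$) is strictly concave if for scalars $a_1,\ldots,a_n\ge0$ the equality $M(a_1,\ldots,a_n)=\sum_k r_ka_k$ implies $a_1=\cdots=a_n$; here a scalar $a\ge 0$ is identified with $aI$ (and $M(a_1I,\ldots,a_nI)$ is a scalar multiple of $I$). A probability vector is a vector with nonnegative entries summing to $1$. *)

theory Defs
  imports "HOL-Analysis.Analysis" "Jordan_Normal_Form.Schur_Decomposition"
begin

section \<open>Complex Hilbert spaces\<close>

text \<open>Definiteness of \<open>cinner\<close> and its compatibility with the norm are inherited from
  \<open>real_inner\<close> through the last axiom: the ambient real inner product is \<open>Re \<circ> cinner\<close>.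
  The form is linear in its first argument.\<close>

class chilbert_space = real_inner + complete_space +
  fixes scaleC :: "complex \<Rightarrow> 'a \<Rightarrow> 'a" (infixr "*\<^sub>C" 75)
    and cinner :: "'a \<Rightarrow> 'a \<Rightarrow> complex"
  assumes scaleC_add_right: "c *\<^sub>C (x + y) = c *\<^sub>C x + c *\<^sub>C y"
    and scaleC_add_left: "(c + d) *\<^sub>C x = c *\<^sub>C x + d *\<^sub>C x"
    and scaleC_scaleC: "c *\<^sub>C (d *\<^sub>C x) = (c * d) *\<^sub>C x"
    and scaleC_of_real: "complex_of_real r *\<^sub>C x = r *\<^sub>R x"
    and cinner_commute: "cinner x y = cnj (cinner y x)"
    and cinner_add_left: "cinner (x + y) z = cinner x z + cinner y z"
    and cinner_scaleC_left: "cinner (c *\<^sub>C x) y = c * cinner x y"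
    and inner_eq_Re_cinner: "inner x y = Re (cinner x y)"


section \<open>Bounded operators\<close>

text \<open>The type \<open>'a \<Rightarrow>\<^sub>L 'a\<close> consists of the bounded \<^emph>\<open>real\<close>-linear maps; \<open>B(H)\<close> is the
  subset of complex-linear ones.\<close>

definition bounded_operators :: "('a::chilbert_space \<Rightarrow>\<^sub>L 'a) set" where
  "bounded_operators = {A. \<forall>c x. blinfun_apply A (c *\<^sub>C x) = c *\<^sub>C blinfun_apply A x}"

definition positive_op :: "('a::chilbert_space \<Rightarrow>\<^sub>L 'a) \<Rightarrow> bool" where
  "positive_op A \<longleftrightarrow> A \<in> bounded_operators \<and>
     (\<forall>x. cinner (blinfun_apply A x) x \<in> \<real> \<and> 0 \<le> Re (cinner (blinfun_apply A x) x))"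

definition op_le :: "('a::chilbert_space \<Rightarrow>\<^sub>L 'a) \<Rightarrow> ('a \<Rightarrow>\<^sub>L 'a) \<Rightarrow> bool" (infix "\<le>\<^sub>o\<^sub>p" 50) where
  "A \<le>\<^sub>o\<^sub>p B \<longleftrightarrow> positive_op (B - A)"

definition op_decreases_to :: "(nat \<Rightarrow> 'a::chilbert_space \<Rightarrow>\<^sub>L 'a) \<Rightarrow> ('a \<Rightarrow>\<^sub>L 'a) \<Rightarrow> bool"
    (infix "\<down>\<^sub>o\<^sub>p" 50) where
  "X \<down>\<^sub>o\<^sub>p A \<longleftrightarrow> (\<forall>m. X (Suc m) \<le>\<^sub>o\<^sub>p X m) \<and>
     (\<forall>x. (\<lambda>m. blinfun_apply (X m) x) \<longlonglongrightarrow> blinfun_apply A x)"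

definition wot_tendsto :: "(nat \<Rightarrow> 'a::chilbert_space \<Rightarrow>\<^sub>L 'a) \<Rightarrow> ('a \<Rightarrow>\<^sub>L 'a) \<Rightarrow> bool" where
  "wot_tendsto X A \<longleftrightarrow>
     (\<forall>x y. (\<lambda>m. cinner (blinfun_apply (X m) x) y) \<longlonglongrightarrow> cinner (blinfun_apply A x) y)"

definition invertible_op :: "('a::real_normed_vector \<Rightarrow>\<^sub>L 'a) \<Rightarrow> bool" where
  "invertible_op A \<longleftrightarrow> (\<exists>T. T o\<^sub>L A = id_blinfun \<and> A o\<^sub>L T = id_blinfun)"

definition op_inverse :: "('a::real_normed_vector \<Rightarrow>\<^sub>L 'a) \<Rightarrow> ('a \<Rightarrow>\<^sub>L 'a)" where
  "op_inverse A = (THE T. T o\<^sub>L A = id_blinfun \<and> A o\<^sub>L T = id_blinfun)"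

definition op_sqrt :: "('a::chilbert_space \<Rightarrow>\<^sub>L 'a) \<Rightarrow> ('a \<Rightarrow>\<^sub>L 'a)" where
  "op_sqrt A = (THE R. positive_op R \<and> R o\<^sub>L R = A)"

definition op_poly :: "real poly \<Rightarrow> ('a::real_normed_vector \<Rightarrow>\<^sub>L 'a) \<Rightarrow> ('a \<Rightarrow>\<^sub>L 'a)" where
  "op_poly p A = (\<Sum>i\<le>degree p. coeff p i *\<^sub>R (((o\<^sub>L) A) ^^ i) id_blinfun)"

text \<open>Continuous functional calculus \<open>f(A)\<close> for \<open>A\<close> positive and \<open>f\<close> continuous on
  \<open>[0,\<infinity>)\<close>: the norm limit of \<open>p\<^sub>k(A)\<close> for polynomials \<open>p\<^sub>k \<rightarrow> f\<close> uniformly on \<open>[0,\<parallel>A\<parallel>]\<close>,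
  an interval that contains the spectrum of \<open>A\<close>. By the Weierstrass theorem such \<open>p\<^sub>k\<close> exist,
  and the limit does not depend on their choice.\<close>

definition op_fun :: "(real \<Rightarrow> real) \<Rightarrow> ('a::chilbert_space \<Rightarrow>\<^sub>L 'a) \<Rightarrow> ('a \<Rightarrow>\<^sub>L 'a)" where
  "op_fun f A = (THE T. \<forall>p :: nat \<Rightarrow> real poly.
     uniform_limit {0..norm A} (\<lambda>k. poly (p k)) f sequentially \<longrightarrow>
     (\<lambda>k. op_poly (p k) A) \<longlonglongrightarrow> T)"


section \<open>Operator monotone functions on the positive half-line\<close>

definition unitary_mat :: "nat \<Rightarrow> complex mat \<Rightarrow> bool" where
  "unitary_mat n U \<longleftrightarrow> U \<in> carrier_mat n n \<and>
     mat_adjoint U * U = 1\<^sub>m n \<and> U * mat_adjoint U = 1\<^sub>m n"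

definition psd_mat :: "nat \<Rightarrow> complex mat \<Rightarrow> bool" where
  "psd_mat n B \<longleftrightarrow> B \<in> carrier_mat n n \<and>
     (\<forall>x\<in>carrier_vec n. (B *\<^sub>v x) \<bullet>c x \<in> \<real> \<and> 0 \<le> Re ((B *\<^sub>v x) \<bullet>c x))"

definition spectral_mat :: "nat \<Rightarrow> complex mat \<Rightarrow> (nat \<Rightarrow> real) \<Rightarrow> complex mat" where
  "spectral_mat n U d = U * mat_diag n (\<lambda>i. complex_of_real (d i)) * mat_adjoint U"

text \<open>Operator monotone means matrix monotone of every order \<open>n\<close>, independently of the
  Hilbert space under consideration. By the spectral theorem the positive definite
  matrices are the \<open>spectral_mat n U d\<close> with \<open>U\<close> unitary and \<open>d > 0\<close>, and \<open>f\<close> of such a matrix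
  is \<open>spectral_mat n U (f \<circ> d)\<close>.\<close>

definition operator_monotone :: "(real \<Rightarrow> real) \<Rightarrow> bool" where
  "operator_monotone f \<longleftrightarrow> (\<forall>n U V d e.
     unitary_mat n U \<longrightarrow> unitary_mat n V \<longrightarrow> (\<forall>i<n. 0 < d i \<and> 0 < e i) \<longrightarrow>
     psd_mat n (spectral_mat n V e - spectral_mat n U d) \<longrightarrow>
     psd_mat n (spectral_mat n V (f \<circ> e) - spectral_mat n U (f \<circ> d)))"


section \<open>Operator means\<close>

text \<open>An \<open>n\<close>-tuple of operators is given by a function \<open>nat \<Rightarrow> 'a \<Rightarrow>\<^sub>L 'a\<close> of which only the
  entries at \<open>1, \<dots>, n\<close> matter. Monotonicity (in both directions) forces an operator
  mean to depend only on these entries.\<close>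

definition pos_tuple :: "nat \<Rightarrow> (nat \<Rightarrow> 'a::chilbert_space \<Rightarrow>\<^sub>L 'a) \<Rightarrow> bool" where
  "pos_tuple n A \<longleftrightarrow> (\<forall>j\<in>{1..n}. positive_op (A j))"

definition operator_mean ::
  "nat \<Rightarrow> ((nat \<Rightarrow> 'a::chilbert_space \<Rightarrow>\<^sub>L 'a) \<Rightarrow> 'a \<Rightarrow>\<^sub>L 'a) \<Rightarrow> bool" where
  "operator_mean n M \<longleftrightarrow>
     (\<forall>A. pos_tuple n A \<longrightarrow> positive_op (M A)) \<and>
     (\<forall>A B. pos_tuple n A \<longrightarrow> pos_tuple n B \<longrightarrow> (\<forall>j\<in>{1..n}. A j \<le>\<^sub>o\<^sub>p B j) \<longrightarrow> M A \<le>\<^sub>o\<^sub>p M B) \<and>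
     (\<forall>A S. pos_tuple n A \<longrightarrow> positive_op S \<longrightarrow>
        S o\<^sub>L M A o\<^sub>L S \<le>\<^sub>o\<^sub>p M (\<lambda>j. S o\<^sub>L A j o\<^sub>L S)) \<and>
     (\<forall>X A. (\<forall>k. pos_tuple n (X k)) \<longrightarrow> pos_tuple n A \<longrightarrow>
        (\<forall>j\<in>{1..n}. (\<lambda>k. X k j) \<down>\<^sub>o\<^sub>p A j) \<longrightarrow> (\<lambda>k. M (X k)) \<down>\<^sub>o\<^sub>p M A) \<and>
     M (\<lambda>j. id_blinfun) = id_blinfun"

text \<open>The value \<open>f 0\<close>, needed for singular \<open>B\<close>, is the limit of \<open>f\<close> at \<open>0\<close>; this
  is what continuity on \<open>[0,\<infinity>)\<close> expresses, operator monotone functions being continuous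
  on \<open>(0,\<infinity>)\<close>.\<close>

definition kubo_ando_correspondence :: "'a::chilbert_space itself \<Rightarrow> bool" where
  "kubo_ando_correspondence _ \<longleftrightarrow>
     (\<forall>\<sigma> :: (nat \<Rightarrow> 'a \<Rightarrow>\<^sub>L 'a) \<Rightarrow> 'a \<Rightarrow>\<^sub>L 'a. operator_mean 2 \<sigma> \<longrightarrow>
       (\<exists>f. operator_monotone f \<and> (\<forall>t>0. 0 < f t) \<and> f 1 = 1 \<and> continuous_on {0..} f \<and>
         (\<forall>A B. positive_op A \<longrightarrow> invertible_op A \<longrightarrow> positive_op B \<longrightarrow>
            (let R = op_sqrt A; R' = op_inverse R in
             \<sigma> (\<lambda>j. if j = 1 then A else B) = R o\<^sub>L op_fun f (R' o\<^sub>L B o\<^sub>L R') o\<^sub>L R))))"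

definition trivial_mean ::
  "nat \<Rightarrow> ((nat \<Rightarrow> 'a::chilbert_space \<Rightarrow>\<^sub>L 'a) \<Rightarrow> 'a \<Rightarrow>\<^sub>L 'a) \<Rightarrow> bool" where
  "trivial_mean n M \<longleftrightarrow> (\<exists>i\<in>{1..n}. \<forall>A. pos_tuple n A \<longrightarrow> M A = A i)"

definition arithmetic_mean ::
  "nat \<Rightarrow> ((nat \<Rightarrow> 'a::chilbert_space \<Rightarrow>\<^sub>L 'a) \<Rightarrow> 'a \<Rightarrow>\<^sub>L 'a) \<Rightarrow> bool" where
  "arithmetic_mean n M \<longleftrightarrow>
     (\<exists>r :: nat \<Rightarrow> real. (\<forall>k\<in>{1..n}. 0 \<le> r k) \<and> (\<Sum>k=1..n. r k) = 1 \<and>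
        (\<forall>A. pos_tuple n A \<longrightarrow> M A = (\<Sum>k=1..n. r k *\<^sub>R A k)))"

definition affinely_dominated_by ::
  "nat \<Rightarrow> (nat \<Rightarrow> real) \<Rightarrow> ((nat \<Rightarrow> 'a::chilbert_space \<Rightarrow>\<^sub>L 'a) \<Rightarrow> 'a \<Rightarrow>\<^sub>L 'a) \<Rightarrow> bool" where
  "affinely_dominated_by n r M \<longleftrightarrow>
     (\<forall>k\<in>{1..n}. 0 < r k \<and> r k < 1) \<and> (\<Sum>k=1..n. r k) = 1 \<and>
     (\<forall>A. pos_tuple n A \<longrightarrow> M A \<le>\<^sub>o\<^sub>p (\<Sum>k=1..n. r k *\<^sub>R A k))"

definition affinely_dominated ::
  "nat \<Rightarrow> ((nat \<Rightarrow> 'a::chilbert_space \<Rightarrow>\<^sub>L 'a) \<Rightarrow> 'a \<Rightarrow>\<^sub>L 'a) \<Rightarrow> bool" where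
  "affinely_dominated n M \<longleftrightarrow> (\<exists>r. affinely_dominated_by n r M)"

definition strictly_concave ::
  "nat \<Rightarrow> ((nat \<Rightarrow> 'a::chilbert_space \<Rightarrow>\<^sub>L 'a) \<Rightarrow> 'a \<Rightarrow>\<^sub>L 'a) \<Rightarrow> bool" where
  "strictly_concave n M \<longleftrightarrow>
     (\<exists>r. affinely_dominated_by n r M \<and>
        (\<forall>a :: nat \<Rightarrow> real. (\<forall>k\<in>{1..n}. 0 \<le> a k) \<longrightarrow>
           M (\<lambda>k. a k *\<^sub>R id_blinfun) = (\<Sum>k=1..n. r k * a k) *\<^sub>R id_blinfun \<longrightarrow>
           (\<forall>i\<in>{1..n}. \<forall>j\<in>{1..n}. a i = a j)))"

primrec mean_iteration ::
  "nat \<Rightarrow> (nat \<Rightarrow> (nat \<Rightarrow> 'a::chilbert_space \<Rightarrow>\<^sub>L 'a) \<Rightarrow> 'a \<Rightarrow>\<^sub>L 'a) \<Rightarrow>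
   (nat \<Rightarrow> 'a \<Rightarrow>\<^sub>L 'a) \<Rightarrow> nat \<Rightarrow> nat \<Rightarrow> 'a \<Rightarrow>\<^sub>L 'a" where
  "mean_iteration n M A 0 = A"
| "mean_iteration n M A (Suc m) =
     (\<lambda>k. M k (\<lambda>j. mean_iteration n M A m ((k + j) mod (n + 1))))"

end

theory Submission
  imports Defs
begin

text \<open>Let \<open>p\<close> be the stationary vector of the stochastic matrix formed by the dominating weights. By
  affine domination the sums \<open>\<Sum> p\<^sub>k A\<^sub>m\<^sup>(\<^sup>k\<^sup>)\<close> decrease, hence converge strongly to some \<open>S\<close>. Compressing to a
  rank-one projection reduces the iteration to the numbers \<open>\<langle>A\<^sub>m\<^sup>(\<^sup>k\<^sup>) x, x\<rangle>\<close>: the domination gaps are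
  summable, so by strict concavity (or, in the arithmetic case, by a variance argument) the differences
  of these numbers tend to \<open>0\<close>, and all of them tend to \<open>\<langle>S x, x\<rangle>\<close>. Conversely, a vector \<open>p\<close> for which
  the sums decrease is stationary: an operator monotone function below the weighted arithmetic mean lies above
  the weighted harmonic mean with the same weights, so the scalar means have the dominating weights as partial
  derivatives at \<open>(1, \<dots>, 1)\<close>.\<close>

section \<open>Hilbert space preliminaries\<close>

text \<open>The numbers q_m(k) attached to a unit vector are not themselves an iteration of scalar
  means: compression yields only q_(m+1)(k) \<le> g_k(q_m) \<le> (weighted arithmetic mean of q_m),
  with g_k the restriction of M_k to scalars. Because the two bounds are nested, the vanishing of
  the outer gap forces the gap between g_k and its arithmetic bound to vanish as well. A strictly
  concave M_k then equates all sequences except the k-th, which it does not see; two such means with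
  a common third index compare everything, and n \<ge> 2 with at most one exception supplies them.
  For uniqueness, the arithmetic bound touches the scalar mean at the diagonal and fixes the
  derivatives there once they exist. Their existence comes from a lower bound with the same tangent,
  derived from monotonicity on 2 x 2 matrices in place of the analyticity of operator monotone
  functions.\<close>

lemma norm_1_inner: "norm (x :: 'a::real_inner) = 1 \<Longrightarrow> inner x x = 1"
  by (simp add: power2_norm_eq_inner[symmetric])

lemma cinner_add_right: "cinner (x::'a::chilbert_space) (y + z) = cinner x y + cinner x z"
  by (metis cinner_add_left cinner_commute complex_cnj_add)

lemma cinner_scaleC_right: "cinner (x::'a::chilbert_space) (c *\<^sub>C y) = cnj c * cinner x y"
  by (metis cinner_commute cinner_scaleC_left complex_cnj_mult)

lemma cinner_scaleR_left: "cinner (r *\<^sub>R x) (y::'a::chilbert_space) = of_real r * cinner x y"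
  by (metis cinner_scaleC_left scaleC_of_real)

lemma cinner_diff_left: "cinner (x - y) (z::'a::chilbert_space) = cinner x z - cinner y z"
  by (metis add_diff_cancel cinner_add_left diff_add_cancel)

lemma cinner_self: "cinner (x::'a::chilbert_space) x = of_real ((norm x)\<^sup>2)"
proof -
  have "Im (cinner x x) = 0"
    using cinner_commute[of x x] by (metis Reals_cnj_iff complex_is_Real_iff)
  moreover have "Re (cinner x x) = (norm x)\<^sup>2"
    by (metis inner_eq_Re_cinner power2_norm_eq_inner)
  ultimately show ?thesis by (simp add: complex_eq_iff)
qed

lemma Im_cinner: "Im (cinner (x::'a::chilbert_space) y) = inner x (\<i> *\<^sub>C y)"
  unfolding inner_eq_Re_cinner unfolding cinner_scaleC_right by simp

text \<open>Symmetry and limits can be proved for the real form \<open>inner\<close> and carried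
  over to \<open>cinner\<close> at the end.\<close>

lemma cinner_eq_inner: "cinner (x::'a::chilbert_space) y = Complex (inner x y) (inner x (\<i> *\<^sub>C y))"
  by (rule complex_eqI) (simp_all add: Im_cinner, simp add: inner_eq_Re_cinner)

lemma norm_scaleC: "norm (c *\<^sub>C (x::'a::chilbert_space)) = cmod c * norm x"
proof -
  have "of_real ((norm (c *\<^sub>C x))\<^sup>2) = (of_real ((cmod c * norm x)\<^sup>2) :: complex)"
    unfolding cinner_self[symmetric] cinner_scaleC_left cinner_scaleC_right
    using complex_norm_square[of c] by (simp add: cinner_self power_mult_distrib mult.commute)
  then have "(norm (c *\<^sub>C x))\<^sup>2 = (cmod c * norm x)\<^sup>2"
    using of_real_eq_iff by blast
  then show ?thesis by (simp add: power2_eq_iff_nonneg)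
qed

lemma scaleC_scaleR: "c *\<^sub>C (r *\<^sub>R (x::'a::chilbert_space)) = r *\<^sub>R (c *\<^sub>C x)"
  by (metis scaleC_of_real scaleC_scaleC mult.commute)

lemma bounded_linear_scaleC: "bounded_linear (\<lambda>x::'a::chilbert_space. c *\<^sub>C x)"
  by (rule bounded_linear_intro[where K = "cmod c"])
    (simp_all add: scaleC_add_right scaleC_scaleR norm_scaleC mult.commute)

lemma norm_cinner_le: "cmod (cinner (x::'a::chilbert_space) y) \<le> norm x * norm y"
proof (cases "cinner x y = 0")
  case False
  \<comment> \<open>Multiplying \<open>x\<close> by this phase turns the inner product into its
    modulus, which leaves the real Cauchy-Schwarz inequality.\<close>
  define c where "c = cnj (cinner x y) / of_real (cmod (cinner x y))"
  have c: "cmod c = 1" using False by (simp add: c_def norm_divide)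
  have "inner (c *\<^sub>C x) y = Re (c * cinner x y)"
    by (simp add: inner_eq_Re_cinner cinner_scaleC_left)
  also have "c * cinner x y = of_real (cmod (cinner x y))"
  proof -
    have "cnj (cinner x y) * cinner x y = of_real (cmod (cinner x y)) * of_real (cmod (cinner x y))"
      using complex_norm_square[of "cinner x y"] by (simp add: power2_eq_square mult.commute)
    then show ?thesis using False by (simp add: c_def)
  qed
  finally show ?thesis
    using norm_cauchy_schwarz[of "c *\<^sub>C x" y] by (simp add: norm_scaleC c)
qed simp

subsection \<open>Positive operators\<close>

lemma bounded_operators_add:
  "A \<in> bounded_operators \<Longrightarrow> B \<in> bounded_operators \<Longrightarrow> A + B \<in> bounded_operators"
  by (simp add: bounded_operators_def blinfun.add_left scaleC_add_right)

lemma bounded_operators_scaleR: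
  "A \<in> bounded_operators \<Longrightarrow> r *\<^sub>R A \<in> bounded_operators"
  by (simp add: bounded_operators_def blinfun.scaleR_left scaleC_scaleR)

lemma bounded_operators_diff:
  assumes "A \<in> bounded_operators" "B \<in> bounded_operators"
  shows "A - B \<in> bounded_operators"
  using bounded_operators_add[OF assms(1) bounded_operators_scaleR[OF assms(2), of "-1"]] by simp

lemma positive_op_inner_nonneg: "positive_op A \<Longrightarrow> 0 \<le> inner (blinfun_apply A x) x"
  by (simp add: positive_op_def inner_eq_Re_cinner)

lemma positive_op_bounded_operators: "positive_op A \<Longrightarrow> A \<in> bounded_operators"
  by (simp add: positive_op_def)

lemma positive_op_zero: "positive_op 0"
  by (simp add: positive_op_def bounded_operators_def cinner_eq_inner
    complex_is_Real_iff linear_0[OF bounded_linear.linear[OF bounded_linear_scaleC]])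

lemma positive_op_id: "positive_op id_blinfun"
  by (simp add: positive_op_def bounded_operators_def cinner_self)

lemma positive_op_add: "positive_op A \<Longrightarrow> positive_op B \<Longrightarrow> positive_op (A + B)"
  by (auto simp: positive_op_def blinfun.add_left cinner_add_left intro: bounded_operators_add)

lemma positive_op_scaleR: "positive_op A \<Longrightarrow> 0 \<le> r \<Longrightarrow> positive_op (r *\<^sub>R A)"
  by (auto simp: positive_op_def blinfun.scaleR_left cinner_scaleR_left
      intro: bounded_operators_scaleR)

lemma positive_op_sum:
  assumes "\<And>i. i \<in> I \<Longrightarrow> positive_op (A i)"
  shows "positive_op (\<Sum>i\<in>I. A i)"
  using assms by (induction I rule: infinite_finite_induct) (auto intro: positive_op_zero positive_op_add)

text \<open>Complex scalars are essential: the quadratic form is real at x + i y as well, and this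
  gives symmetry of the real form. Nonnegativity of a quadratic form on a real space would
  not.\<close>

lemma positive_op_selfadjoint:
  assumes "positive_op A"
  shows "cinner (blinfun_apply A x) y = cinner x (blinfun_apply A y)"
proof -
  have *: "inner (blinfun_apply A x) y = inner x (blinfun_apply A y)" for x y
  proof -
    have lin: "blinfun_apply A (c *\<^sub>C z) = c *\<^sub>C blinfun_apply A z" for c z
      using assms by (simp add: positive_op_def bounded_operators_def)
    have "Im (cinner (blinfun_apply A z) z) = 0" for z
      using assms by (simp add: positive_op_def complex_is_Real_iff)
    from this[of "x + \<i> *\<^sub>C y"] this[of x] this[of y]
    have "Re (cinner (blinfun_apply A x) y) = Re (cinner (blinfun_apply A y) x)"
      by (simp add: blinfun.add_right lin cinner_add_left cinner_add_right cinner_scaleC_left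
          cinner_scaleC_right)
    then show ?thesis by (simp add: inner_eq_Re_cinner[symmetric] inner_commute)
  qed
  have "blinfun_apply A (\<i> *\<^sub>C y) = \<i> *\<^sub>C blinfun_apply A y"
    using assms by (simp add: positive_op_def bounded_operators_def)
  then show ?thesis by (simp add: cinner_eq_inner *)
qed

lemma positive_op_symmetric:
  "positive_op A \<Longrightarrow> inner (blinfun_apply A x) y = inner x (blinfun_apply A y)"
  by (simp add: inner_eq_Re_cinner positive_op_selfadjoint)

lemma positive_op_Cauchy_Schwarz:
  assumes "positive_op A"
  shows "(inner (blinfun_apply A x) y)\<^sup>2
    \<le> inner (blinfun_apply A x) x * inner (blinfun_apply A y) y"
proof -
  let ?q = "\<lambda>x y. inner (blinfun_apply A x) y"
  have pos: "0 \<le> ?q x x + 2 * t * ?q x y + t\<^sup>2 * ?q y y" for t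
  proof -
    have "?q y x = ?q x y" using positive_op_symmetric[OF assms, of y x] by (simp add: inner_commute)
    then show ?thesis
      using positive_op_inner_nonneg[OF assms, of "x + t *\<^sub>R y"]
      by (simp add: blinfun.add_right blinfun.scaleR_right inner_add_left inner_add_right
          algebra_simps power2_eq_square)
  qed
  have nn: "0 \<le> ?q y y" "0 \<le> ?q x x" using assms by (simp_all add: positive_op_inner_nonneg)
  show ?thesis
  proof (cases "?q y y = 0")
    case True
    have "?q x y = 0"
    proof (rule ccontr)
      assume "?q x y \<noteq> 0"
      \<comment> \<open>With vanishing quadratic term the polynomial is affine in t; the chosen t
        gives it the value -1.\<close>
      then show False
        using pos[of "- (?q x x + 1) / (2 * ?q x y)"] True by (simp add: field_simps)
    qed
    then show ?thesis using True by simp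
  next
    case False
    then show ?thesis using pos[of "- ?q x y / ?q y y"] nn
      by (simp add: field_simps power2_eq_square)
  qed
qed

lemma positive_op_apply_eq_0:
  assumes "positive_op A" "inner (blinfun_apply A x) x = 0"
  shows "blinfun_apply A x = 0"
  using positive_op_Cauchy_Schwarz[OF assms(1), of x "blinfun_apply A x"] assms(2) by simp

lemma op_le_refl: "A \<le>\<^sub>o\<^sub>p A"
  by (simp add: op_le_def positive_op_zero)

lemma op_le_trans: "A \<le>\<^sub>o\<^sub>p B \<Longrightarrow> B \<le>\<^sub>o\<^sub>p C \<Longrightarrow> A \<le>\<^sub>o\<^sub>p C"
  unfolding op_le_def using positive_op_add[of "B - A" "C - B"] by simp

lemma op_le_inner: "A \<le>\<^sub>o\<^sub>p B \<Longrightarrow> inner (blinfun_apply A x) x \<le> inner (blinfun_apply B x) x"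
  unfolding op_le_def using positive_op_inner_nonneg[of "B - A" x]
  by (simp add: blinfun.diff_left inner_diff_left)

lemma op_le_scaleR_id:
  "a \<le> b \<Longrightarrow> a *\<^sub>R id_blinfun \<le>\<^sub>o\<^sub>p b *\<^sub>R (id_blinfun :: 'a::chilbert_space \<Rightarrow>\<^sub>L 'a)"
  unfolding op_le_def
  using positive_op_scaleR[OF positive_op_id, of "b - a"] by (simp add: scaleR_left_diff_distrib)

lemma op_le_antisym:
  assumes "A \<le>\<^sub>o\<^sub>p B" "B \<le>\<^sub>o\<^sub>p A"
  shows "A = B"
proof (rule blinfun_eqI)
  fix x
  have "inner (blinfun_apply (B - A) x) x = 0"
    using op_le_inner[OF assms(1), of x] op_le_inner[OF assms(2), of x]
    by (simp add: blinfun.diff_left inner_diff_left)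
  then have "blinfun_apply (B - A) x = 0"
    using assms(1) by (intro positive_op_apply_eq_0) (auto simp: op_le_def)
  then show "blinfun_apply A x = blinfun_apply B x" by (simp add: blinfun.diff_left)
qed

text \<open>Cauchy-Schwarz for the form of \<open>D\<close> at the pair x, D x bounds the fourth
  power of the norm of D x by the form at \<open>x\<close> times the form at D x, and the latter is
  controlled by \<open>X\<close>. This upgrades convergence of quadratic forms to norm convergence
  without operator square roots.\<close>

lemma norm_apply_le_op_le:
  assumes "positive_op D" "D \<le>\<^sub>o\<^sub>p X"
  shows "(norm (blinfun_apply D x))\<^sup>2 \<le> norm X * inner (blinfun_apply D x) x"
proof -
  let ?y = "blinfun_apply D x"
  have "inner (blinfun_apply D ?y) ?y \<le> inner (blinfun_apply X ?y) ?y"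
    by (rule op_le_inner[OF assms(2)])
  also have "\<dots> \<le> norm (blinfun_apply X ?y) * norm ?y" by (rule norm_cauchy_schwarz)
  also have "\<dots> \<le> norm X * norm ?y * norm ?y"
    by (intro mult_right_mono norm_blinfun) auto
  finally have "inner (blinfun_apply D ?y) ?y \<le> norm X * (norm ?y)\<^sup>2"
    by (simp add: power2_eq_square mult.assoc)
  then have "inner (blinfun_apply D x) x * inner (blinfun_apply D ?y) ?y
      \<le> inner (blinfun_apply D x) x * (norm X * (norm ?y)\<^sup>2)"
    using positive_op_inner_nonneg[OF assms(1)] by (intro mult_left_mono)
  then have *: "(norm ?y)\<^sup>2 * (norm ?y)\<^sup>2 \<le> (norm X * inner (blinfun_apply D x) x) * (norm ?y)\<^sup>2"
    using positive_op_Cauchy_Schwarz[OF assms(1), of x ?y]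
    by (simp add: power2_norm_eq_inner[symmetric] power2_eq_square[of "(norm ?y)\<^sup>2"] mult_ac)
  moreover have "0 \<le> norm X * inner (blinfun_apply D x) x"
    using positive_op_inner_nonneg[OF assms(1)] by simp
  ultimately show ?thesis
  proof (cases "?y = 0")
    case False
    then have "0 < (norm ?y)\<^sup>2" by simp
    with * show ?thesis by (rule mult_right_le_imp_le)
  qed simp
qed

section \<open>Strong and weak limits of positive operators\<close>

text \<open>Vigier's theorem. The forms of \<open>X m\<close> decrease and hence converge; the
  preceding estimate, applied to the differences \<open>X m - X k\<close>, which lie below
  \<open>X 0\<close>, makes the sequence Cauchy at each vector.\<close>

lemma decreasing_positive_op_converges:
  fixes X :: "nat \<Rightarrow> 'a::chilbert_space \<Rightarrow>\<^sub>L 'a"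
  assumes pos: "\<And>m. positive_op (X m)" and dec: "\<And>m. X (Suc m) \<le>\<^sub>o\<^sub>p X m"
  shows "\<exists>S\<in>bounded_operators. X \<down>\<^sub>o\<^sub>p S"
proof -
  have le: "X k \<le>\<^sub>o\<^sub>p X m" if "m \<le> k" for m k
    using that by (induction rule: dec_induct) (auto intro: op_le_refl op_le_trans dec)
  have bound: "norm (blinfun_apply (X m) x) \<le> norm x * norm (X 0)" for m x
  proof (cases "blinfun_apply (X m) x = 0")
    case False
    have "(norm (blinfun_apply (X m) x))\<^sup>2 \<le> norm (X 0) * inner (blinfun_apply (X m) x) x"
      by (rule norm_apply_le_op_le[OF pos le]) simp
    also have "\<dots> \<le> norm (X 0) * (norm (blinfun_apply (X m) x) * norm x)"
      by (intro mult_left_mono norm_cauchy_schwarz) simp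
    finally show ?thesis using False by (simp add: power2_eq_square algebra_simps)
  qed simp
  have "Cauchy (\<lambda>m. blinfun_apply (X m) x)" for x
  proof (rule CauchyI')
    fix e :: real assume e: "0 < e"
    define q where "q m = inner (blinfun_apply (X m) x) x" for m
    have "decseq q" unfolding decseq_Suc_iff q_def using dec by (auto intro: op_le_inner)
    moreover have "0 \<le> q m" for m using pos by (simp add: q_def positive_op_inner_nonneg)
    ultimately have "convergent q"
      by (metis decseq_convergent convergentI)
    then have "Cauchy q" by (rule convergent_Cauchy)
    \<comment> \<open>The added 1 keeps the denominator positive when \<open>X 0\<close> is
      zero.\<close>
    moreover have "0 < e\<^sup>2 / (norm (X 0) + 1)" using e by (simp add: add_nonneg_pos)
    ultimately obtain N where N: "\<And>m k. N \<le> m \<Longrightarrow> N \<le> k \<Longrightarrow> dist (q m) (q k) < e\<^sup>2 / (norm (X 0) + 1)"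
      unfolding Cauchy_def by metis
    have "dist (blinfun_apply (X m) x) (blinfun_apply (X k) x) < e" if "N \<le> m" "m < k" for m k
    proof -
      have D: "positive_op (X m - X k)" using le[of m k] that by (simp add: op_le_def)
      have "X m - X k \<le>\<^sub>o\<^sub>p X 0"
        using le[of 0 m] positive_op_add[OF _ pos[of k], of "X 0 - X m"]
        by (simp add: op_le_def algebra_simps)
      then have "(norm (blinfun_apply (X m - X k) x))\<^sup>2 \<le> norm (X 0) * (q m - q k)"
        using norm_apply_le_op_le[OF D] by (simp add: q_def blinfun.diff_left inner_diff_left)
      also have "\<dots> \<le> norm (X 0) * \<bar>q m - q k\<bar>"
        by (intro mult_left_mono) auto
      also have "\<dots> \<le> (norm (X 0) + 1) * \<bar>q m - q k\<bar>"
        by (intro mult_right_mono) auto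
      also have "\<dots> < e\<^sup>2"
        using N[of m k] that by (simp add: dist_real_def pos_less_divide_eq add_nonneg_pos mult.commute)
      finally show ?thesis
        using e by (auto simp: dist_norm blinfun.diff_left intro: power_less_imp_less_base)
    qed
    then show "\<exists>M. \<forall>m\<ge>M. \<forall>n>m. dist (blinfun_apply (X m) x) (blinfun_apply (X n) x) < e"
      by blast
  qed
  then have "\<forall>x. \<exists>l. (\<lambda>m. blinfun_apply (X m) x) \<longlonglongrightarrow> l"
    using Cauchy_convergent convergent_def by blast
  then obtain s where s: "\<And>x. (\<lambda>m. blinfun_apply (X m) x) \<longlonglongrightarrow> s x" by metis
  have "bounded_linear s"
  proof (rule bounded_linear_intro[where K = "norm (X 0)"])
    show "s (x + y) = s x + s y" for x y
      using tendsto_add[OF s[of x] s[of y]] s[of "x + y"]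
      by (simp add: blinfun.add_right LIMSEQ_unique)
    show "s (r *\<^sub>R x) = r *\<^sub>R s x" for r x
      using tendsto_scaleR[OF tendsto_const s[of x], of r] s[of "r *\<^sub>R x"]
      by (simp add: blinfun.scaleR_right LIMSEQ_unique)
    show "norm (s x) \<le> norm x * norm (X 0)" for x
      by (rule LIMSEQ_le_const2[OF tendsto_norm[OF s[of x]]]) (use bound in auto)
  qed
  then have ap: "blinfun_apply (Blinfun s) = s" by (rule bounded_linear_Blinfun_apply)
  have "s (c *\<^sub>C x) = c *\<^sub>C s x" for c x
  proof -
    have "(\<lambda>m. c *\<^sub>C blinfun_apply (X m) x) \<longlonglongrightarrow> c *\<^sub>C s x"
      by (rule bounded_linear.tendsto[OF bounded_linear_scaleC s])
    then show ?thesis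
      using s[of "c *\<^sub>C x"] pos by (simp add: positive_op_def bounded_operators_def LIMSEQ_unique)
  qed
  then show ?thesis
    using s dec by (intro bexI[of _ "Blinfun s"]) (auto simp: op_decreases_to_def bounded_operators_def ap)
qed

text \<open>Real polarization recovers the bilinear form only of a symmetric operator. The positive
  sequence \<open>Y\<close> converging strongly to \<open>S\<close> is there to make
  \<open>S\<close> symmetric.\<close>

lemma wot_tendsto_quadratic_form:
  fixes X :: "nat \<Rightarrow> 'a::chilbert_space \<Rightarrow>\<^sub>L 'a"
  assumes pos: "\<And>m. positive_op (X m)" and S: "Y \<down>\<^sub>o\<^sub>p S" "\<And>m. positive_op (Y m)"
    and lim: "\<And>x. (\<lambda>m. inner (blinfun_apply (X m) x) x) \<longlonglongrightarrow> inner (blinfun_apply S x) x"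
  shows "wot_tendsto X S"
proof -
  have polar: "inner (blinfun_apply A x) y = (inner (blinfun_apply A (x + y)) (x + y)
      - inner (blinfun_apply A (x - y)) (x - y)) / 4"
    if "\<And>x y. inner (blinfun_apply A x) y = inner x (blinfun_apply A y)" for A :: "'a \<Rightarrow>\<^sub>L 'a" and x y
  proof -
    have "inner (blinfun_apply A y) x = inner (blinfun_apply A x) y"
      by (metis that inner_commute)
    then show ?thesis
      by (simp add: blinfun.add_right blinfun.diff_right inner_add_left
        inner_add_right inner_diff_left inner_diff_right)
  qed
  have symS: "inner (blinfun_apply S x) y = inner x (blinfun_apply S y)" for x y
  proof -
    have "(\<lambda>m. inner (blinfun_apply (Y m) x) y) \<longlonglongrightarrow> inner (blinfun_apply S x) y"
      and "(\<lambda>m. inner x (blinfun_apply (Y m) y)) \<longlonglongrightarrow> inner x (blinfun_apply S y)"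
      using S(1) unfolding op_decreases_to_def
      by (rule_tac tendsto_inner tendsto_const; blast)+
    then show ?thesis using S(2) by (simp add: positive_op_symmetric LIMSEQ_unique)
  qed
  have "(\<lambda>m. inner (blinfun_apply (X m) x) y) \<longlonglongrightarrow> inner (blinfun_apply S x) y" for x y
  proof -
    have "(\<lambda>m. (inner (blinfun_apply (X m) (x + y)) (x + y)
        - inner (blinfun_apply (X m) (x - y)) (x - y)) / 4) \<longlonglongrightarrow> inner (blinfun_apply S x) y"
      by (subst polar[OF symS]) (intro tendsto_intros lim, simp)
    then show ?thesis
      by (subst polar[OF positive_op_symmetric[OF pos]])
  qed
  then show ?thesis
    unfolding wot_tendsto_def cinner_eq_inner by (intro allI tendsto_Complex)
qed


section \<open>Operator means of scalars\<close>

text \<open>Positive for every \<open>x\<close>, but a projection only when \<open>x\<close> is a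
  unit vector or zero.\<close>

definition rank_one_proj :: "'a::chilbert_space \<Rightarrow> 'a \<Rightarrow>\<^sub>L 'a" where
  "rank_one_proj x = Blinfun (\<lambda>y. cinner y x *\<^sub>C x)"

lemma rank_one_proj_apply: "blinfun_apply (rank_one_proj x) y = cinner y x *\<^sub>C x"
proof -
  have "bounded_linear (\<lambda>y. cinner y x *\<^sub>C x)"
  proof (rule bounded_linear_intro[where K = "norm x * norm x"])
    show "norm (cinner y x *\<^sub>C x) \<le> norm y * (norm x * norm x)" for y
      using norm_cinner_le[of y x] by (simp add: norm_scaleC mult.assoc[symmetric] mult_right_mono)
  qed (simp_all add: cinner_add_left scaleC_add_left cinner_scaleR_left scaleC_of_real flip: scaleC_scaleC)
  then show ?thesis by (simp add: rank_one_proj_def bounded_linear_Blinfun_apply)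
qed

lemma cinner_rank_one_proj:
  "cinner (blinfun_apply (rank_one_proj x) y) y = of_real ((cmod (cinner y x))\<^sup>2)"
  by (simp only: rank_one_proj_apply cinner_scaleC_left complex_norm_square cinner_commute[of x y])

lemma positive_op_rank_one_proj: "positive_op (rank_one_proj x)"
  unfolding positive_op_def cinner_rank_one_proj
  by (simp add: bounded_operators_def rank_one_proj_apply cinner_scaleC_left scaleC_scaleC)

lemma rank_one_proj_le_id:
  assumes "norm x = 1"
  shows "rank_one_proj x \<le>\<^sub>o\<^sub>p id_blinfun"
proof -
  have "0 \<le> Re (cinner (blinfun_apply (id_blinfun - rank_one_proj x) y) y)" for y
    using power_mono[OF norm_cinner_le[of y x], of 2] assms
    by (simp add: blinfun.diff_left cinner_diff_left cinner_rank_one_proj cinner_self del: of_real_power)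
  moreover have "cinner (blinfun_apply (id_blinfun - rank_one_proj x) y) y \<in> \<real>" for y
    by (simp add: blinfun.diff_left cinner_diff_left cinner_rank_one_proj cinner_self del: of_real_power)
  moreover have "id_blinfun - rank_one_proj x \<in> bounded_operators"
    using positive_op_rank_one_proj positive_op_id
    by (intro bounded_operators_diff positive_op_bounded_operators)
  ultimately show ?thesis by (simp add: op_le_def positive_op_def)
qed

lemma rank_one_proj_compress:
  assumes "positive_op A"
  shows "rank_one_proj x o\<^sub>L A o\<^sub>L rank_one_proj x = inner (blinfun_apply A x) x *\<^sub>R rank_one_proj x"
proof (rule blinfun_eqI)
  fix y
  have "cinner (blinfun_apply A x) x = of_real (inner (blinfun_apply A x) x)"
    using assms by (simp add: positive_op_def inner_eq_Re_cinner)
  moreover have "blinfun_apply A (cinner y x *\<^sub>C x) = cinner y x *\<^sub>C blinfun_apply A x"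
    using assms by (simp add: positive_op_def bounded_operators_def)
  ultimately show "blinfun_apply (rank_one_proj x o\<^sub>L A o\<^sub>L rank_one_proj x) y
      = blinfun_apply (inner (blinfun_apply A x) x *\<^sub>R rank_one_proj x) y"
    by (simp add: rank_one_proj_apply cinner_scaleC_left blinfun.scaleR_left scaleC_of_real
        scaleC_scaleR flip: scaleC_scaleC)
qed

lemma rank_one_proj_scalar_compress:
  assumes "norm x = 1"
  shows "rank_one_proj x o\<^sub>L (a *\<^sub>R id_blinfun) o\<^sub>L rank_one_proj x = a *\<^sub>R rank_one_proj x"
proof (rule blinfun_eqI)
  fix y
  have "(of_real a * cinner y x) *\<^sub>C x = a *\<^sub>R (cinner y x *\<^sub>C x)"
    by (metis scaleC_of_real scaleC_scaleC)
  then show "blinfun_apply (rank_one_proj x o\<^sub>L (a *\<^sub>R id_blinfun) o\<^sub>L rank_one_proj x) y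
      = blinfun_apply (a *\<^sub>R rank_one_proj x) y"
    using assms by (simp add: rank_one_proj_apply blinfun.scaleR_left cinner_scaleC_left
        cinner_scaleR_left cinner_self)
qed

text \<open>The first-order term of the hypothesis at \<open>x + t v\<close>, for \<open>v\<close> orthogonal to \<open>x\<close>, shows that
  every vector is an eigenvector of \<open>T\<close>.\<close>

lemma scalar_of_rank_one_compressions:
  fixes T :: "'a::chilbert_space \<Rightarrow>\<^sub>L 'a"
  assumes T: "positive_op T"
    and comp: "\<And>x. norm x = 1 \<Longrightarrow> rank_one_proj x o\<^sub>L T o\<^sub>L rank_one_proj x \<le>\<^sub>o\<^sub>p T"
  shows "\<exists>c\<ge>0. T = c *\<^sub>R id_blinfun"
proof -
  have eig: "blinfun_apply T x = inner (blinfun_apply T x) x *\<^sub>R x" if x: "norm x = 1" for x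
  proof -
    define \<tau> where "\<tau> = inner (blinfun_apply T x) x"
    define v where "v = blinfun_apply T x - \<tau> *\<^sub>R x"
    have Tx: "cinner (blinfun_apply T x) x = of_real \<tau>"
      using T by (simp add: positive_op_def \<tau>_def inner_eq_Re_cinner)
    have vx: "cinner v x = 0"
      using x by (simp add: v_def cinner_diff_left cinner_scaleR_left Tx cinner_self)
    have ivx: "inner v x = 0" using vx by (simp add: inner_eq_Re_cinner)
    have Txv: "inner (blinfun_apply T x) v = (norm v)\<^sup>2"
    proof -
      have "blinfun_apply T x = v + \<tau> *\<^sub>R x" by (simp add: v_def)
      then show ?thesis using ivx
        by (simp add: inner_add_left power2_norm_eq_inner inner_commute[of x v])
    qed
    have Tvx: "inner (blinfun_apply T v) x = (norm v)\<^sup>2"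
      using positive_op_symmetric[OF T, of v x] Txv by (simp add: inner_commute)
    have "0 \<le> 2 * t * (norm v)\<^sup>2 + t\<^sup>2 * inner (blinfun_apply T v) v" for t
    proof -
      \<comment> \<open>On x + t v the compressed operator keeps the constant value \<tau>, so no
        negative first-order term may remain on the side of \<open>T\<close>.\<close>
      let ?y = "x + t *\<^sub>R v"
      have "cinner ?y x = 1"
        using vx x by (simp add: cinner_add_left cinner_scaleR_left cinner_self)
      then have "inner (blinfun_apply (\<tau> *\<^sub>R rank_one_proj x) ?y) ?y = \<tau>"
        by (simp add: blinfun.scaleR_left inner_eq_Re_cinner cinner_rank_one_proj cinner_scaleR_left)
      then have "\<tau> \<le> inner (blinfun_apply T ?y) ?y"
        using op_le_inner[OF comp[OF x], of ?y] rank_one_proj_compress[OF T, of x]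
        by (simp add: \<tau>_def)
      also have "\<dots> = \<tau> + 2 * t * (norm v)\<^sup>2 + t\<^sup>2 * inner (blinfun_apply T v) v"
        by (simp add: blinfun.add_right blinfun.scaleR_right inner_add_left inner_add_right
            Txv Tvx \<tau>_def power2_eq_square algebra_simps)
      finally show ?thesis by simp
    qed
    note quad = this
    have "v = 0"
    proof (rule ccontr)
      assume "v \<noteq> 0"
      define b where "b = (norm v)\<^sup>2"
      define c where "c = inner (blinfun_apply T v) v"
      have b: "0 < b" using \<open>v \<noteq> 0\<close> by (simp add: b_def)
      have c: "0 \<le> c" using T by (simp add: c_def positive_op_inner_nonneg)
      \<comment> \<open>Negative, and small enough for the linear term to outweigh the quadratic
        one; the added 1 covers c = 0.\<close>
      define t where "t = - b / (c + 1)"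
      have t: "t < 0" "t * (c + 1) = - b" using b c by (simp_all add: t_def)
      then have "t * c = - b - t" by (simp add: algebra_simps)
      then have "0 < 2 * b + t * c" using b t by simp
      then have "t * (2 * b + t * c) < 0" using t by (simp add: mult_neg_pos)
      then show False using quad[of t] by (simp add: b_def c_def power2_eq_square algebra_simps)
    qed
    then show ?thesis by (simp add: v_def \<tau>_def)
  qed
  show ?thesis
  proof (cases "\<exists>x::'a. x \<noteq> 0")
    case False
    then have "T = 0 *\<^sub>R id_blinfun" by (intro blinfun_eqI) metis
    then show ?thesis by blast
  next
    case True
    then obtain x :: 'a where x: "norm x = 1"
      by (metis norm_sgn)
    define c where "c = inner (blinfun_apply T x) x"
    have c: "0 \<le> c" using T by (simp add: c_def positive_op_inner_nonneg)
    have Tx: "blinfun_apply T x = c *\<^sub>R x" using eig[OF x] by (simp add: c_def)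
    have eig': "\<exists>\<tau>. blinfun_apply T y = \<tau> *\<^sub>R y" for y
    proof (cases "y = 0")
      case False
      have "blinfun_apply T y = norm y *\<^sub>R blinfun_apply T (sgn y)"
        using False by (simp add: sgn_div_norm blinfun.scaleR_right)
      also have "\<dots> = norm y *\<^sub>R inner (blinfun_apply T (sgn y)) (sgn y) *\<^sub>R sgn y"
        using eig[of "sgn y"] False by (simp add: norm_sgn)
      also have "\<dots> = inner (blinfun_apply T (sgn y)) (sgn y) *\<^sub>R y"
        using False by (simp add: sgn_div_norm)
      finally show ?thesis by blast
    qed (simp add: blinfun.zero_right)
    \<comment> \<open>By symmetry, non-orthogonal eigenvectors share their eigenvalue. A vector
      \<open>y\<close> orthogonal to \<open>x\<close> is then reached through
      \<open>y + x\<close>.\<close>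
    have nonorth: "blinfun_apply T y = c *\<^sub>R y" if "inner y x \<noteq> 0" for y
    proof -
      obtain \<tau> where \<tau>: "blinfun_apply T y = \<tau> *\<^sub>R y" using eig' by blast
      have "\<tau> * inner y x = c * inner y x"
        using positive_op_symmetric[OF T, of y x] by (simp add: \<tau> Tx)
      then show ?thesis using that \<tau> by simp
    qed
    have "blinfun_apply T y = c *\<^sub>R y" for y
    proof (cases "inner y x = 0")
      case True
      then have "inner (y + x) x \<noteq> 0" using x by (simp add: inner_add_left power2_norm_eq_inner[symmetric])
      from nonorth[OF this] show ?thesis by (simp add: blinfun.add_right Tx scaleR_add_right)
    qed (rule nonorth)
    then have "T = c *\<^sub>R id_blinfun" by (intro blinfun_eqI) (simp add: blinfun.scaleR_left)
    then show ?thesis using c by blast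
  qed
qed

lemma pos_tuple_scalar: "(\<And>j. j \<in> {1..n} \<Longrightarrow> 0 \<le> a j) \<Longrightarrow> pos_tuple n (\<lambda>j. a j *\<^sub>R id_blinfun)"
  by (simp add: pos_tuple_def positive_op_scaleR positive_op_id)

lemma operator_mean_positive: "operator_mean n M \<Longrightarrow> pos_tuple n A \<Longrightarrow> positive_op (M A)"
  by (simp add: operator_mean_def)

lemma operator_mean_mono:
  "operator_mean n M \<Longrightarrow> pos_tuple n A \<Longrightarrow> pos_tuple n B \<Longrightarrow> (\<And>j. j \<in> {1..n} \<Longrightarrow> A j \<le>\<^sub>o\<^sub>p B j)
    \<Longrightarrow> M A \<le>\<^sub>o\<^sub>p M B"
  by (simp add: operator_mean_def)

lemma operator_mean_cong:
  assumes "operator_mean n M" "pos_tuple n A" "\<And>j. j \<in> {1..n} \<Longrightarrow> A j = B j"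
  shows "M A = M B"
proof -
  have B: "pos_tuple n B" using assms(2,3) by (simp add: pos_tuple_def)
  show ?thesis
  proof (rule op_le_antisym)
    show "M A \<le>\<^sub>o\<^sub>p M B"
      by (rule operator_mean_mono[OF assms(1,2) B]) (simp add: assms(3) op_le_refl)
    show "M B \<le>\<^sub>o\<^sub>p M A"
      by (rule operator_mean_mono[OF assms(1) B assms(2)]) (simp add: assms(3) op_le_refl)
  qed
qed

lemma operator_mean_transformer:
  "operator_mean n M \<Longrightarrow> pos_tuple n A \<Longrightarrow> positive_op S
    \<Longrightarrow> S o\<^sub>L M A o\<^sub>L S \<le>\<^sub>o\<^sub>p M (\<lambda>j. S o\<^sub>L A j o\<^sub>L S)"
  by (simp add: operator_mean_def)

text \<open>Monotonicity and P \<le> I. It undoes a compression: once the transformer inequality has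
  produced multiples of P, this bound returns to multiples of the identity.\<close>

lemma operator_mean_rank_one:
  assumes M: "operator_mean n M" and a: "\<And>j. j \<in> {1..n} \<Longrightarrow> 0 \<le> a j" and x: "norm x = 1"
  shows "M (\<lambda>j. a j *\<^sub>R rank_one_proj x) \<le>\<^sub>o\<^sub>p M (\<lambda>j. a j *\<^sub>R id_blinfun)"
proof (rule operator_mean_mono[OF M _ pos_tuple_scalar[OF a]])
  show "pos_tuple n (\<lambda>j. a j *\<^sub>R rank_one_proj x)"
    using a by (simp add: pos_tuple_def positive_op_scaleR positive_op_rank_one_proj)
  show "a j *\<^sub>R rank_one_proj x \<le>\<^sub>o\<^sub>p a j *\<^sub>R id_blinfun" if "j \<in> {1..n}" for j
    using positive_op_scaleR[OF _ a[OF that], of "id_blinfun - rank_one_proj x"]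
      rank_one_proj_le_id[OF x] by (simp add: op_le_def scaleR_diff_right)
qed

text \<open>The transformer inequality followed by the previous bound gives P T P \<le> T for every
  rank-one projection P, and only scalars satisfy this.\<close>

lemma operator_mean_scalar:
  assumes M: "operator_mean n M" and a: "\<And>j. j \<in> {1..n} \<Longrightarrow> 0 \<le> a j"
  shows "\<exists>c\<ge>0. M (\<lambda>j. a j *\<^sub>R id_blinfun) = c *\<^sub>R id_blinfun"
proof (rule scalar_of_rank_one_compressions)
  show "positive_op (M (\<lambda>j. a j *\<^sub>R id_blinfun))"
    by (rule operator_mean_positive[OF M pos_tuple_scalar[OF a]])
  show "rank_one_proj x o\<^sub>L M (\<lambda>j. a j *\<^sub>R id_blinfun) o\<^sub>L rank_one_proj x
      \<le>\<^sub>o\<^sub>p M (\<lambda>j. a j *\<^sub>R id_blinfun)" if x: "norm x = 1" for x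
    using operator_mean_transformer[OF M pos_tuple_scalar[OF a] positive_op_rank_one_proj[of x]]
      operator_mean_rank_one[OF M a x]
    unfolding rank_one_proj_scalar_compress[OF x] by (rule op_le_trans)
qed

text \<open>With P the projection onto \<open>x\<close> and a_j the state of the j-th entry, P M(A)
  P \<le> M(a_1 P, ...) \<le> M(a_1 I, ...); evaluate at \<open>x\<close>. This is the passage from
  operators to numbers.\<close>

lemma operator_mean_vector_state:
  assumes M: "operator_mean n M" and A: "pos_tuple n A" and x: "norm x = 1"
  shows "inner (blinfun_apply (M A) x) x
    \<le> inner (blinfun_apply (M (\<lambda>j. inner (blinfun_apply (A j) x) x *\<^sub>R id_blinfun)) x) x"
proof -
  let ?a = "\<lambda>j. inner (blinfun_apply (A j) x) x"
  let ?P = "rank_one_proj x"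
  have a: "0 \<le> ?a j" if "j \<in> {1..n}" for j
    using A that by (simp add: pos_tuple_def positive_op_inner_nonneg)
  have eq: "M (\<lambda>j. ?P o\<^sub>L A j o\<^sub>L ?P) = M (\<lambda>j. ?a j *\<^sub>R ?P)"
    using A a
    by (intro operator_mean_cong[OF M])
      (auto simp: pos_tuple_def rank_one_proj_compress positive_op_scaleR positive_op_rank_one_proj)
  have "?P o\<^sub>L M A o\<^sub>L ?P \<le>\<^sub>o\<^sub>p M (\<lambda>j. ?a j *\<^sub>R id_blinfun)"
    using operator_mean_transformer[OF M A positive_op_rank_one_proj[of x]] unfolding eq
    by (rule op_le_trans[OF _ operator_mean_rank_one[OF M a x]])
  from op_le_inner[OF this, of x] show ?thesis
    using x by (simp add: rank_one_proj_compress[OF operator_mean_positive[OF M A]] blinfun.scaleR_left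
        rank_one_proj_apply cinner_self scaleC_of_real[of 1, simplified] power2_norm_eq_inner[symmetric])
qed


section \<open>Operator monotone functions\<close>

definition rotation_mat :: "real \<Rightarrow> real \<Rightarrow> complex mat" where
  "rotation_mat c s = Matrix.mat 2 2
     (\<lambda>(i, j). complex_of_real (if i = j then c else if i = 0 then - s else s))"

definition sym_mat2 :: "real \<Rightarrow> real \<Rightarrow> real \<Rightarrow> complex mat" where
  "sym_mat2 a q b = Matrix.mat 2 2
     (\<lambda>(i, j). complex_of_real (if i \<noteq> j then q else if i = 0 then a else b))"

lemma mat_adjoint_rotation: "mat_adjoint (rotation_mat c s) = rotation_mat c (- s)"
  by (rule eq_matI) (auto simp: rotation_mat_def mat_adjoint_def mat_of_rows_def)

lemma unitary_mat_rotation: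
  assumes "c\<^sup>2 + s\<^sup>2 = 1"
  shows "unitary_mat 2 (rotation_mat c s)"
proof -
  have "rotation_mat c s * rotation_mat c (- s) = 1\<^sub>m 2"
    if "c\<^sup>2 + s\<^sup>2 = 1" for c s
  proof -
    have "complex_of_real c * complex_of_real c + complex_of_real s * complex_of_real s = 1"
      using that by (simp add: power2_eq_square flip: of_real_mult of_real_add)
    then show ?thesis
      by (intro eq_matI) (auto simp: rotation_mat_def scalar_prod_def less_2_cases_iff
          numeral_2_eq_2 algebra_simps)
  qed
  from this[OF assms] this[of c "- s"] assms show ?thesis
    by (simp add: unitary_mat_def mat_adjoint_rotation) (simp add: rotation_mat_def)
qed

lemma spectral_mat_rotation:
  "spectral_mat 2 (rotation_mat c s) e
    = sym_mat2 (e 0 * c\<^sup>2 + e 1 * s\<^sup>2) ((e 0 - e 1) * c * s) (e 0 * s\<^sup>2 + e 1 * c\<^sup>2)"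
  unfolding spectral_mat_def mat_adjoint_rotation
  by (rule eq_matI) (auto simp: rotation_mat_def sym_mat2_def mat_diag_def scalar_prod_def
      less_2_cases_iff numeral_2_eq_2 power2_eq_square algebra_simps)

lemma sym_mat2_diff: "sym_mat2 a q b - sym_mat2 a' q' b' = sym_mat2 (a - a') (q - q') (b - b')"
  by (rule eq_matI) (auto simp: sym_mat2_def)

lemma psd_sym_mat2:
  "psd_mat 2 (sym_mat2 a q b) \<longleftrightarrow> (\<forall>x y :: real. 0 \<le> a * x\<^sup>2 + 2 * q * x * y + b * y\<^sup>2)"
proof -
  have form: "(sym_mat2 a q b *\<^sub>v v) \<bullet>c v = of_real ((a * (Re (vec_index v 0))\<^sup>2
      + 2 * q * Re (vec_index v 0) * Re (vec_index v 1) + b * (Re (vec_index v 1))\<^sup>2)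
      + (a * (Im (vec_index v 0))\<^sup>2 + 2 * q * Im (vec_index v 0) * Im (vec_index v 1) + b * (Im (vec_index v 1))\<^sup>2))"
    if "v \<in> carrier_vec 2" for v
    using that by (auto simp: sym_mat2_def scalar_prod_def numeral_2_eq_2 complex_eq_iff
        power2_eq_square algebra_simps)
  show ?thesis
  proof
    assume psd: "psd_mat 2 (sym_mat2 a q b)"
    show "\<forall>x y :: real. 0 \<le> a * x\<^sup>2 + 2 * q * x * y + b * y\<^sup>2"
    proof (intro allI)
      fix x y :: real
      define v where "v = Matrix.vec 2 (\<lambda>i. complex_of_real (if i = 0 then x else y))"
      have v: "v \<in> carrier_vec 2" by (simp add: v_def)
      have "0 \<le> Re ((sym_mat2 a q b *\<^sub>v v) \<bullet>c v)"
        using psd v by (auto simp: psd_mat_def)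
      then show "0 \<le> a * x\<^sup>2 + 2 * q * x * y + b * y\<^sup>2"
        unfolding form[OF v] by (simp add: v_def)
    qed
  next
    assume "\<forall>x y :: real. 0 \<le> a * x\<^sup>2 + 2 * q * x * y + b * y\<^sup>2"
    then show "psd_mat 2 (sym_mat2 a q b)"
      unfolding psd_mat_def by (auto simp: form add_nonneg_nonneg) (simp add: sym_mat2_def)
  qed
qed

text \<open>Monotonicity of order 2, read off quadratic forms: diag(u, v) is compared with the
  matrix having eigenvalues \<open>w\<close>, \<open>z\<close> on the basis vectors (c, s), (-s,
  c).\<close>

lemma operator_monotone_rotation:
  assumes f: "operator_monotone f" and cs: "c\<^sup>2 + s\<^sup>2 = 1"
    and pos: "0 < u" "0 < v" "0 < w" "0 < z"
    and le: "\<And>x y. u * x\<^sup>2 + v * y\<^sup>2 \<le> w * (c * x + s * y)\<^sup>2 + z * (c * y - s * x)\<^sup>2"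
  shows "f u * x\<^sup>2 + f v * y\<^sup>2 \<le> f w * (c * x + s * y)\<^sup>2 + f z * (c * y - s * x)\<^sup>2"
proof -
  define d where "d i = (if i = 0 then u else v)" for i :: nat
  define e where "e i = (if i = 0 then w else z)" for i :: nat
  have form: "spectral_mat 2 (rotation_mat c s) e' - spectral_mat 2 (rotation_mat 1 0) d'
      = sym_mat2 (e' 0 * c\<^sup>2 + e' 1 * s\<^sup>2 - d' 0) ((e' 0 - e' 1) * c * s)
        (e' 0 * s\<^sup>2 + e' 1 * c\<^sup>2 - d' 1)" for d' e'
    by (simp add: spectral_mat_rotation sym_mat2_diff)
  have "psd_mat 2 (spectral_mat 2 (rotation_mat c s) e - spectral_mat 2 (rotation_mat 1 0) d)"
    unfolding form psd_sym_mat2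
  proof (intro allI)
    fix x y
    show "0 \<le> (e 0 * c\<^sup>2 + e 1 * s\<^sup>2 - d 0) * x\<^sup>2 + 2 * ((e 0 - e 1) * c * s) * x * y
        + (e 0 * s\<^sup>2 + e 1 * c\<^sup>2 - d 1) * y\<^sup>2"
      using le[of x y] by (simp add: d_def e_def power2_eq_square algebra_simps)
  qed
  moreover have "\<forall>i<2. 0 < d i \<and> 0 < e i" using pos by (simp add: d_def e_def)
  moreover have "unitary_mat 2 (rotation_mat c s)" "unitary_mat 2 (rotation_mat 1 0)"
    using cs by (simp_all add: unitary_mat_rotation)
  ultimately have "psd_mat 2 (spectral_mat 2 (rotation_mat c s) (f \<circ> e)
      - spectral_mat 2 (rotation_mat 1 0) (f \<circ> d))"
    using f unfolding operator_monotone_def by blast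
  from this[unfolded form psd_sym_mat2, rule_format, of x y] show ?thesis
    by (simp add: d_def e_def power2_eq_square algebra_simps)
qed

text \<open>For \<open>w = 1/a\<close>, \<open>z = 1/b\<close> and \<open>u\<close> just below the weighted harmonic mean of \<open>w\<close>, \<open>z\<close>, a matrix
  with eigenvalues \<open>w\<close>, \<open>z\<close> dominates \<open>diag(u, v)\<close> for small \<open>v\<close>; a test vector does the rest.\<close>

lemma operator_monotone_adjoint_concave:
  assumes f: "operator_monotone f" and fpos: "\<And>t. 0 < t \<Longrightarrow> 0 < f t" and cont: "continuous_on {0..} f"
    and ab: "0 < a" "0 < b" and l: "0 \<le> l" "l \<le> 1"
  shows "l / f (1 / a) + (1 - l) / f (1 / b) \<le> 1 / f (1 / (l * a + (1 - l) * b))"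
proof -
  define w z c s h where "w = 1 / a" and "z = 1 / b" and "c = sqrt l" and "s = sqrt (1 - l)"
    and "h = 1 / (l * a + (1 - l) * b)"
  have wz: "0 < w" "0 < z" using ab by (simp_all add: w_def z_def)
  have c2: "c\<^sup>2 = l" and s2: "s\<^sup>2 = 1 - l" using l by (simp_all add: c_def s_def)
  have m: "0 < l * a + (1 - l) * b"
    using ab l by (cases "l = 0") (auto intro: add_pos_nonneg)
  have h: "0 < h" using m by (simp add: h_def)
  define S where "S = l / f w + (1 - l) / f z"
  have fwz: "0 < f w" "0 < f z" using wz fpos by auto
  have S: "0 \<le> S" using l fwz by (simp add: S_def)
  have *: "f u * S \<le> 1" if u: "0 < u" "u < h" for u
  proof -
    \<comment> \<open>The rotated matrix has diagonal entries \<open>k\<close>, \<open>g\<close> and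
      determinant w z. Its Schur complement w z / g equals \<open>h\<close>, so u < h leaves room
      for a positive \<open>v\<close>.\<close>
    define g where "g = (1 - l) * w + l * z"
    define k where "k = l * w + (1 - l) * z"
    have hg: "h * g = w * z"
      using ab m by (simp add: h_def g_def w_def z_def field_simps)
    have g: "0 < g"
      using wz l by (cases "l = 1") (auto simp: g_def intro: add_pos_nonneg)
    have kg: "k * g = w * z + l * (1 - l) * (w - z)\<^sup>2"
      by (simp add: k_def g_def power2_eq_square algebra_simps)
    have "h * g \<le> k * g" using kg hg l by simp
    then have "h \<le> k" using g by simp
    then have ku: "0 < k - u" using u by simp
    have gu: "0 < w * z - u * g" using u g by (simp flip: hg)
    \<comment> \<open>The largest admissible value: it makes the determinant (k - u) (g - v) - q^2
      of the difference vanish.\<close>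
    define v where "v = (w * z - u * g) / (k - u)"
    have v: "0 < v" using ku gu by (simp add: v_def)
    have le: "u * x\<^sup>2 + v * y\<^sup>2 \<le> w * (c * x + s * y)\<^sup>2 + z * (c * y - s * x)\<^sup>2" for x y
    proof -
      define q where "q = (w - z) * c * s"
      have q2: "q\<^sup>2 = (w - z)\<^sup>2 * l * (1 - l)"
        by (simp add: q_def power_mult_distrib c2 s2)
      have vk: "v * (k - u) = w * z - u * g" using ku by (simp add: v_def)
      have "(k - u) * (w * (c * x + s * y)\<^sup>2 + z * (c * y - s * x)\<^sup>2 - u * x\<^sup>2 - v * y\<^sup>2)
          = (k - u) * ((k - u) * x\<^sup>2 + 2 * q * x * y + (g - v) * y\<^sup>2)"
      proof -
        have "w * (c * x + s * y)\<^sup>2 + z * (c * y - s * x)\<^sup>2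
            = (w * c\<^sup>2 + z * s\<^sup>2) * x\<^sup>2 + 2 * q * x * y + (w * s\<^sup>2 + z * c\<^sup>2) * y\<^sup>2"
          by (simp add: q_def power2_eq_square algebra_simps)
        then have "w * (c * x + s * y)\<^sup>2 + z * (c * y - s * x)\<^sup>2 - u * x\<^sup>2 - v * y\<^sup>2
            = (k - u) * x\<^sup>2 + 2 * q * x * y + (g - v) * y\<^sup>2"
          by (simp add: c2 s2 k_def g_def algebra_simps)
        then show ?thesis by simp
      qed
      also have "\<dots> = ((k - u) * x + q * y)\<^sup>2 + ((k - u) * g - v * (k - u) - q\<^sup>2) * y\<^sup>2"
        by (simp add: power2_eq_square algebra_simps)
      also have "(k - u) * g - v * (k - u) - q\<^sup>2 = 0"
        using kg vk unfolding q2 by (simp add: algebra_simps)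
      finally have "0 \<le> (k - u) * (w * (c * x + s * y)\<^sup>2 + z * (c * y - s * x)\<^sup>2 - u * x\<^sup>2 - v * y\<^sup>2)"
        by simp
      then show ?thesis using ku by (simp add: zero_le_mult_iff)
    qed
    \<comment> \<open>For B the rotated matrix, (x, y) is the inverse of f(B) applied to the first
      basis vector, so the form of f(B) there equals the first coordinate.\<close>
    define x y where "x = c * (c / f w) + s * (s / f z)" and "y = s * (c / f w) - c * (s / f z)"
    have cs: "c\<^sup>2 + s\<^sup>2 = 1" by (simp add: c2 s2)
    have "c * x + s * y = (c\<^sup>2 + s\<^sup>2) * (c / f w)" "c * y - s * x = - ((c\<^sup>2 + s\<^sup>2) * (s / f z))"
      by (simp_all add: x_def y_def power2_eq_square algebra_simps)
    then have xy: "c * x + s * y = c / f w" "c * y - s * x = - (s / f z)" by (simp_all add: cs)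
    have xS: "x = S" using c2 s2 by (simp add: x_def S_def power2_eq_square)
    have "f u * S\<^sup>2 + f v * y\<^sup>2 \<le> f w * (c / f w)\<^sup>2 + f z * (- (s / f z))\<^sup>2"
      using operator_monotone_rotation[OF f cs u(1) v wz le, of x y, unfolded xy] unfolding xS .
    also have "\<dots> = S"
      using fwz by (simp add: power_divide c2 s2 S_def) (simp add: power2_eq_square)
    finally have "f u * S\<^sup>2 \<le> S" using fpos[OF v] by (smt (verit) mult_nonneg_nonneg zero_le_power2)
    then show ?thesis using S by (cases "S = 0") (auto simp: power2_eq_square)
  qed
  \<comment> \<open>At u = h the eigenvalue \<open>v\<close> would be 0, outside the domain of
    operator monotonicity; left continuity at \<open>h\<close> closes the gap.\<close>
  have "isCont f h"
    using cont h by (intro continuous_on_interior[where S = "{0..}"]) (auto simp: interior_real_atLeast)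
  then have "(f \<longlongrightarrow> f h) (at_left h)"
    by (simp add: isCont_def filterlim_at_split)
  then have "((\<lambda>u. f u * S) \<longlongrightarrow> f h * S) (at_left h)" by (intro tendsto_intros)
  moreover have "eventually (\<lambda>u. f u * S \<le> 1) (at_left h)"
    using eventually_at_left_real[OF h] by eventually_elim (use * in auto)
  ultimately have "f h * S \<le> 1"
    by (intro tendsto_upperbound) auto
  then have "S \<le> 1 / f h" using fpos[OF h] by (simp add: field_simps)
  then show ?thesis by (simp add: S_def h_def w_def z_def)
qed

text \<open>The adjoint t \<mapsto> 1 / f (1 / t) is concave with value 1 at 1. The arithmetic bound
  on \<open>f\<close> becomes a lower bound on the adjoint that touches it at 1 with slope 1 - r, so
  concavity keeps the adjoint below the line of that slope. Inverting back gives the claim.\<close>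

lemma operator_monotone_harmonic_le:
  assumes f: "operator_monotone f" and fpos: "\<And>t. 0 < t \<Longrightarrow> 0 < f t" and cont: "continuous_on {0..} f"
    and r: "0 < r" "r < 1" and dom: "\<And>t. 0 < t \<Longrightarrow> f t \<le> r + (1 - r) * t" and f1: "f 1 = 1" and t: "0 < t"
  shows "1 / (r + (1 - r) / t) \<le> f t"
proof -
  define \<tau> where "\<tau> = 1 / t"
  have tau: "0 < \<tau>" using t by (simp add: \<tau>_def)
  have *: "1 / f t \<le> 1 + (1 - r) * (\<tau> - 1) / (1 - r * e * (\<tau> - 1))"
    if e: "0 < e" "e * (\<tau> - 1) < 1" for e
  proof -
    \<comment> \<open>\<open>s\<close> lies on the other side of 1, at a distance scaled by e, so
      that 1 is the convex combination of \<tau> and \<open>s\<close> with weights e / (1 + e) and 1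
      / (1 + e).\<close>
    define s where "s = 1 - e * (\<tau> - 1)"
    have s: "0 < s" using e by (simp add: s_def)
    have l': "1 - e / (1 + e) = 1 / (1 + e)" using e by (simp add: field_simps)
    have "e * \<tau> + s = 1 + e" by (simp add: s_def algebra_simps)
    then have l: "e / (1 + e) * \<tau> + (1 - e / (1 + e)) * s = 1"
      unfolding l' using e by (simp flip: add_divide_distrib)
    have "e / (1 + e) / f t + (1 - e / (1 + e)) / f (1 / s) \<le> 1"
      using operator_monotone_adjoint_concave[OF f fpos cont tau s, of "e / (1 + e)", unfolded l] e
      by (simp add: f1) (simp add: \<tau>_def)
    then have "(e / f t + 1 / f (1 / s)) / (1 + e) \<le> 1"
      unfolding l' using e by (simp add: add_divide_distrib mult.commute)
    then have 1: "e / f t + 1 / f (1 / s) \<le> 1 + e"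
      using e by (simp add: pos_divide_le_eq)
    have d: "0 < r * s + (1 - r)" using r s by (simp add: add_pos_pos)
    have "f (1 / s) \<le> r + (1 - r) / s" using dom[of "1 / s"] s by simp
    also have "\<dots> = (r * s + (1 - r)) / s" using s by (simp add: field_simps)
    finally have "1 / ((r * s + (1 - r)) / s) \<le> 1 / f (1 / s)"
      using fpos[of "1 / s"] s d by (intro divide_left_mono) auto
    then have "s / (r * s + (1 - r)) \<le> 1 / f (1 / s)" by simp
    with 1 have "e / f t \<le> e + (1 - s / (r * s + (1 - r)))" by simp
    also have "1 - s / (r * s + (1 - r)) = (1 - r) * (1 - s) / (r * s + (1 - r))"
      using d by (simp add: field_simps)
    also have "1 - s = e * (\<tau> - 1)" by (simp add: s_def)
    also have "r * s + (1 - r) = 1 - r * e * (\<tau> - 1)" by (simp add: s_def algebra_simps)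
    finally have "e * (1 / f t) \<le> e * (1 + (1 - r) * (\<tau> - 1) / (1 - r * e * (\<tau> - 1)))"
      by (simp add: algebra_simps)
    then show ?thesis by (rule mult_left_le_imp_le) (rule e(1))
  qed
  \<comment> \<open>As e tends to 0 the secant through \<open>s\<close> and 1 becomes the tangent
    line.\<close>
  have "((\<lambda>e. 1 + (1 - r) * (\<tau> - 1) / (1 - r * e * (\<tau> - 1)))
      \<longlongrightarrow> 1 + (1 - r) * (\<tau> - 1) / (1 - r * 0 * (\<tau> - 1))) (at_right 0)"
    by (intro tendsto_intros) simp
  moreover have "eventually (\<lambda>e. 1 / f t \<le> 1 + (1 - r) * (\<tau> - 1) / (1 - r * e * (\<tau> - 1))) (at_right 0)"
  proof -
    have "((\<lambda>e. e * (\<tau> - 1)) \<longlongrightarrow> 0 * (\<tau> - 1)) (at_right 0)" by (intro tendsto_intros)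
    then have "eventually (\<lambda>e. e * (\<tau> - 1) < 1) (at_right 0)" by (rule order_tendstoD(2)) simp
    moreover have "eventually (\<lambda>e::real. 0 < e) (at_right 0)" by (simp add: eventually_at_right_less)
    ultimately show ?thesis by eventually_elim (rule *)
  qed
  ultimately have "1 / f t \<le> 1 + (1 - r) * (\<tau> - 1) / (1 - r * 0 * (\<tau> - 1))"
    by (intro tendsto_lowerbound) auto
  then have "1 / f t \<le> r + (1 - r) / t" by (simp add: \<tau>_def algebra_simps diff_divide_distrib)
  moreover have "0 < r + (1 - r) / t" using r t by (simp add: add_pos_pos)
  ultimately show ?thesis using fpos[OF t] by (simp add: field_simps)
qed


section \<open>Stochastic matrices with vanishing diagonal\<close>

text \<open>The diagonal vanishes because the k-th mean does not read the k-th sequence. With n = 1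
  the matrix would be a swap, whose iterates oscillate.\<close>

locale offdiag_stochastic =
  fixes n :: nat and w :: "nat \<Rightarrow> nat \<Rightarrow> real"
  assumes two_le_n: "2 \<le> n"
    and diag: "k \<le> n \<Longrightarrow> w k k = 0"
    and offdiag: "k \<le> n \<Longrightarrow> l \<le> n \<Longrightarrow> k \<noteq> l \<Longrightarrow> 0 < w k l"
    and row_sum: "k \<le> n \<Longrightarrow> (\<Sum>l\<le>n. w k l) = 1"
begin

lemma w_nonneg: "k \<le> n \<Longrightarrow> l \<le> n \<Longrightarrow> 0 \<le> w k l"
  using diag offdiag by (cases "k = l") (auto intro: less_imp_le)

definition stationary :: "(nat \<Rightarrow> real) \<Rightarrow> bool" where
  "stationary p \<longleftrightarrow> (\<forall>l\<le>n. (\<Sum>k\<le>n. p k * w k l) = p l)"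

lemma stationary_sum:
  assumes "stationary p"
  shows "(\<Sum>k\<le>n. p k * (\<Sum>l\<le>n. w k l * a l)) = (\<Sum>l\<le>n. p l * a l)"
proof -
  have "(\<Sum>k\<le>n. p k * (\<Sum>l\<le>n. w k l * a l)) = (\<Sum>l\<le>n. \<Sum>k\<le>n. p k * w k l * a l)"
    by (subst sum.swap) (simp add: sum_distrib_left mult.assoc)
  also have "\<dots> = (\<Sum>l\<le>n. p l * a l)"
    using assms by (intro sum.cong) (auto simp: stationary_def simp flip: sum_distrib_right)
  finally show ?thesis .
qed

text \<open>Irreducibility: a zero entry makes a sum of nonnegative terms vanish, and every
  off-diagonal weight in it is positive.\<close>

lemma stationary_eq_0:
  assumes p: "stationary p" "\<And>k. k \<le> n \<Longrightarrow> 0 \<le> p k" and l: "l \<le> n" "p l = 0" and k: "k \<le> n"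
  shows "p k = 0"
proof (cases "k = l")
  case False
  have "(\<Sum>k\<le>n. p k * w k l) = 0" using p l by (simp add: stationary_def)
  then have "p k * w k l = 0"
    using p(2) w_nonneg l k by (subst (asm) sum_nonneg_eq_0_iff) auto
  then show ?thesis using offdiag[OF k l(1) False] by simp
qed (use l in simp)

lemma stationary_unique:
  assumes p: "stationary p" "\<And>k. k \<le> n \<Longrightarrow> 0 < p k" "(\<Sum>k\<le>n. p k) = 1"
    and q: "stationary q" "\<And>k. k \<le> n \<Longrightarrow> 0 < q k" "(\<Sum>k\<le>n. q k) = 1"
    and k: "k \<le> n"
  shows "p k = q k"
proof -
  \<comment> \<open>The largest multiple of \<open>q\<close> below \<open>p\<close>: the difference
    is stationary and nonnegative with a zero entry, hence zero throughout.\<close>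
  define t where "t = Min ((\<lambda>k. p k / q k) ` {..n})"
  have "t \<in> (\<lambda>k. p k / q k) ` {..n}" unfolding t_def by (rule Min_in) auto
  then obtain l where l: "l \<le> n" "t = p l / q l" by auto
  have le: "t \<le> p k / q k" if "k \<le> n" for k using that by (simp add: t_def)
  let ?d = "\<lambda>k. p k - t * q k"
  have "stationary ?d"
    using p(1) q(1) unfolding stationary_def
    by (simp add: left_diff_distrib sum_subtractf mult.assoc flip: sum_distrib_left)
  moreover have "0 \<le> ?d k" if "k \<le> n" for k
    using le[OF that] q(2)[OF that] by (simp add: pos_le_divide_eq)
  moreover have "?d l = 0" using l q(2)[OF l(1)] by simp
  ultimately have d: "?d k = 0" if "k \<le> n" for k
    using stationary_eq_0[of ?d l k] l(1) that by blast
  have "(\<Sum>k\<le>n. p k) = t * (\<Sum>k\<le>n. q k)"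
    using d by (simp add: sum_distrib_left)
  then have "t = 1" using p q by simp
  then show ?thesis using d[OF k] by simp
qed

text \<open>The eigenvalue \<open>1\<close> of \<open>w\<close> is one of its transpose as well; taking absolute values in a left
  eigenvector can only increase each entry of the image, but preserves the total.\<close>

lemma stationary_exists:
  "\<exists>p. stationary p \<and> (\<forall>k\<le>n. 0 < p k) \<and> (\<Sum>k\<le>n. p k) = 1"
proof -
  define T where "T = Matrix.mat (n + 1) (n + 1) (\<lambda>(i, j). w i j)"
  define A where "A = transpose_mat T"
  have T: "T \<in> carrier_mat (n + 1) (n + 1)" and A: "A \<in> carrier_mat (n + 1) (n + 1)"
    by (simp_all add: T_def A_def)
  define v1 :: "real Matrix.vec" where "v1 = Matrix.vec (n + 1) (\<lambda>_. 1)"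
  have set: "{0..<Suc n} = {..n}" by auto
  have "eigenvector T v1 1"
    unfolding eigenvector_def
  proof (intro conjI)
    show "v1 \<in> carrier_vec (dim_row T)" by (simp add: v1_def T_def)
    have "vec_index v1 0 \<noteq> vec_index (0\<^sub>v (dim_row T)) 0" by (simp add: v1_def T_def)
    then show "v1 \<noteq> 0\<^sub>v (dim_row T)" by metis
    show "T *\<^sub>v v1 = 1 \<cdot>\<^sub>v v1"
      by (rule eq_vecI) (auto simp: T_def v1_def scalar_prod_def set row_sum)
  qed
  then have "det (char_matrix T 1) = 0"
    using eigenvalue_det[OF T] by (auto simp: eigenvalue_def)
  moreover have "char_matrix A 1 = transpose_mat (char_matrix T 1)"
    by (rule eq_matI) (auto simp: char_matrix_def A_def T_def)
  ultimately have "eigenvalue A 1"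
    using eigenvalue_det[OF A] det_transpose[OF char_matrix_closed[OF T]] by simp
  then obtain v where v: "v \<in> carrier_vec (n + 1)" "v \<noteq> 0\<^sub>v (n + 1)" "A *\<^sub>v v = v"
    by (auto simp: eigenvalue_def eigenvector_def A_def T_def)
  define q where "q k = \<bar>vec_index v k\<bar>" for k
  have vl: "(\<Sum>k\<le>n. vec_index v k * w k l) = vec_index v l" if "l \<le> n" for l
  proof -
    have "vec_index (A *\<^sub>v v) l = (\<Sum>k\<le>n. vec_index v k * w k l)"
      using that v(1) by (simp add: A_def T_def scalar_prod_def set mult.commute)
    then show ?thesis by (simp add: v)
  qed
  have le: "q l \<le> (\<Sum>k\<le>n. q k * w k l)" if "l \<le> n" for l
  proof -
    have "q l \<le> (\<Sum>k\<le>n. \<bar>vec_index v k * w k l\<bar>)"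
      unfolding q_def vl[OF that, symmetric] by (rule sum_abs)
    also have "\<dots> = (\<Sum>k\<le>n. q k * w k l)"
      using w_nonneg that by (intro sum.cong) (auto simp: q_def abs_mult)
    finally show ?thesis .
  qed
  have "(\<Sum>l\<le>n. (\<Sum>k\<le>n. q k * w k l) - q l) = 0"
    by (subst sum_subtractf, subst sum.swap) (simp add: row_sum flip: sum_distrib_left)
  then have "(\<Sum>k\<le>n. q k * w k l) - q l = 0" if "l \<le> n" for l
    using le that by (subst (asm) sum_nonneg_eq_0_iff) auto
  then have st: "stationary q" by (simp add: stationary_def)
  have pos: "0 < q k" if k: "k \<le> n" for k
  proof (rule ccontr)
    assume "\<not> 0 < q k"
    then have "q k = 0" by (simp add: q_def)
    then have "q l = 0" if "l \<le> n" for l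
      using stationary_eq_0[OF st _ k _ that] by (simp add: q_def)
    then have "v = 0\<^sub>v (n + 1)"
      using v(1) by (intro eq_vecI) (auto simp: q_def less_Suc_eq_le)
    with v(2) show False ..
  qed
  define s where "s = (\<Sum>k\<le>n. q k)"
  have s: "0 < s" unfolding s_def using pos by (intro sum_pos) auto
  show ?thesis
  proof (intro exI conjI)
    show "stationary (\<lambda>k. q k / s)"
      using st by (simp add: stationary_def flip: sum_divide_distrib)
    show "\<forall>k\<le>n. 0 < q k / s" using pos s by simp
    show "(\<Sum>k\<le>n. q k / s) = 1" using s by (simp add: s_def flip: sum_divide_distrib)
  qed
qed

text \<open>A decreasing sequence bounded below has vanishing decrements, and each nonnegative
  summand is squeezed by them. It serves both for weighted sums and for weighted sums of
  squares.\<close>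

lemma weighted_decrements_tendsto_0:
  fixes Y :: "nat \<Rightarrow> real"
  assumes Y: "\<And>m. 0 \<le> Y m" and dec: "\<And>m. Y m - Y (Suc m) = (\<Sum>k\<le>n. p k * g m k)"
    and p: "\<And>k. k \<le> n \<Longrightarrow> 0 < p k" and g: "\<And>m k. k \<le> n \<Longrightarrow> 0 \<le> g m k" and k: "k \<le> n"
  shows "(\<lambda>m. g m k) \<longlonglongrightarrow> 0"
proof -
  have bound: "p k * g m k \<le> Y m - Y (Suc m)" for m
    unfolding dec using p g k by (intro member_le_sum) (auto intro: mult_nonneg_nonneg less_imp_le)
  have "decseq Y"
    unfolding decseq_Suc_iff
  proof
    fix m
    have "0 \<le> p k * g m k" using p[OF k] g[OF k] by simp
    then show "Y (Suc m) \<le> Y m" using bound[of m] by simp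
  qed
  then obtain L where L: "Y \<longlonglongrightarrow> L"
    using Y by (metis decseq_convergent)
  then have "(\<lambda>m. (Y m - Y (Suc m)) / p k) \<longlonglongrightarrow> (L - L) / p k"
    using p[OF k] by (intro tendsto_intros LIMSEQ_Suc) auto
  then have lim: "(\<lambda>m. (Y m - Y (Suc m)) / p k) \<longlonglongrightarrow> 0" by simp
  have le: "g m k \<le> (Y m - Y (Suc m)) / p k" for m
    using bound[of m] p[OF k] by (simp add: pos_le_divide_eq mult.commute)
  show ?thesis
    by (rule tendsto_sandwich[OF _ _ tendsto_const lim]) (simp_all only: le g[OF k] eventually_True)
qed

text \<open>By stationarity, the weighted sum drops in one step by exactly the weighted sum of the
  domination gaps.\<close>

lemma dominated_gap_tendsto_0:
  assumes p: "stationary p" "\<And>k. k \<le> n \<Longrightarrow> 0 < p k"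
    and q: "\<And>m k. k \<le> n \<Longrightarrow> 0 \<le> q m k" "\<And>m k. k \<le> n \<Longrightarrow> q (Suc m) k \<le> (\<Sum>l\<le>n. w k l * q m l)"
    and k: "k \<le> n"
  shows "(\<lambda>m. (\<Sum>l\<le>n. w k l * q m l) - q (Suc m) k) \<longlonglongrightarrow> 0"
proof (rule weighted_decrements_tendsto_0[OF _ _ p(2) _ k, where Y = "\<lambda>m. \<Sum>k\<le>n. p k * q m k"])
  show "0 \<le> (\<Sum>k\<le>n. p k * q m k)" for m
    using p(2) q(1) by (intro sum_nonneg) (auto intro: mult_nonneg_nonneg less_imp_le)
  show "(\<Sum>k\<le>n. p k * q m k) - (\<Sum>k\<le>n. p k * q (Suc m) k)
      = (\<Sum>k\<le>n. p k * ((\<Sum>l\<le>n. w k l * q m l) - q (Suc m) k))" for m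
    by (simp add: right_diff_distrib sum_subtractf stationary_sum[OF p(1)])
  show "0 \<le> (\<Sum>l\<le>n. w k l * q m l) - q (Suc m) k" if "k \<le> n" for m k
    using q(2)[OF that] by simp
qed

text \<open>The weighted sum of squares decreases by a weighted sum of variances.\<close>

lemma linear_consensus:
  assumes p: "stationary p" "\<And>k. k \<le> n \<Longrightarrow> 0 < p k"
    and q: "\<And>m k. k \<le> n \<Longrightarrow> q (Suc m) k = (\<Sum>l\<le>n. w k l * q m l)"
    and ij: "i \<le> n" "j \<le> n"
  shows "(\<lambda>m. q m i - q m j) \<longlonglongrightarrow> 0"
proof -
  define V where "V m k = (\<Sum>l\<le>n. w k l * (q m l - q (Suc m) k)\<^sup>2)" for m k
  have V0: "0 \<le> V m k" if "k \<le> n" for m k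
    unfolding V_def using w_nonneg that by (intro sum_nonneg) auto
  \<comment> \<open>\<open>q (Suc m) k\<close> is the mean of \<open>q m\<close> under the k-th row,
    so this is the usual formula for a variance.\<close>
  have Veq: "V m k = (\<Sum>l\<le>n. w k l * (q m l)\<^sup>2) - (q (Suc m) k)\<^sup>2" if "k \<le> n" for m k
  proof -
    let ?c = "q (Suc m) k"
    have "V m k = (\<Sum>l\<le>n. w k l * (q m l)\<^sup>2 - 2 * ?c * (w k l * q m l) + ?c\<^sup>2 * w k l)"
      unfolding V_def by (intro sum.cong) (auto simp: power2_eq_square algebra_simps)
    also have "\<dots> = (\<Sum>l\<le>n. w k l * (q m l)\<^sup>2) - 2 * ?c * ?c + ?c\<^sup>2"
      by (simp only: sum.distrib sum_subtractf sum_distrib_left[symmetric] row_sum[OF that]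
          q[OF that, symmetric])
    finally show ?thesis by (simp add: power2_eq_square)
  qed
  have "(\<lambda>m. V m k) \<longlonglongrightarrow> 0" if "k \<le> n" for k
  proof (rule weighted_decrements_tendsto_0[OF _ _ p(2) V0 that, where Y = "\<lambda>m. \<Sum>k\<le>n. p k * (q m k)\<^sup>2"])
    show "0 \<le> (\<Sum>k\<le>n. p k * (q m k)\<^sup>2)" for m
      using p(2) by (intro sum_nonneg mult_nonneg_nonneg) (auto intro: less_imp_le)
    show "(\<Sum>k\<le>n. p k * (q m k)\<^sup>2) - (\<Sum>k\<le>n. p k * (q (Suc m) k)\<^sup>2) = (\<Sum>k\<le>n. p k * V m k)" for m
      by (simp add: Veq right_diff_distrib sum_subtractf stationary_sum[OF p(1)])
  qed
  note V = this
  have step: "(\<lambda>m. q m l - q (Suc m) k) \<longlonglongrightarrow> 0" if kl: "k \<le> n" "l \<le> n" "k \<noteq> l" for k l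
  proof -
    have wkl: "0 < w k l" using offdiag kl by simp
    have "w k l * (q m l - q (Suc m) k)\<^sup>2 \<le> V m k" for m
      unfolding V_def using w_nonneg kl by (intro member_le_sum[where f = "\<lambda>l. w k l * (q m l - q (Suc m) k)\<^sup>2"]) auto
    then have le: "(q m l - q (Suc m) k)\<^sup>2 \<le> V m k / w k l" for m
      using wkl by (simp add: pos_le_divide_eq mult.commute)
    have lim: "(\<lambda>m. V m k / w k l) \<longlonglongrightarrow> 0"
      using tendsto_divide[OF V[OF kl(1)] tendsto_const[of "w k l"]] wkl by simp
    have "(\<lambda>m. (q m l - q (Suc m) k)\<^sup>2) \<longlonglongrightarrow> 0"
      by (rule tendsto_sandwich[OF _ _ tendsto_const lim]) (simp_all only: le zero_le_power2 eventually_True)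
    then show ?thesis by (simp add: power_tendsto_0_iff)
  qed
  \<comment> \<open>Both entries are compared with the same \<open>q (Suc m) k\<close>, which
    requires a third index.\<close>
  obtain k where k: "k \<le> n" "k \<noteq> i" "k \<noteq> j"
  proof -
    have "(0 \<noteq> i \<and> 0 \<noteq> j) \<or> (1 \<noteq> i \<and> 1 \<noteq> j) \<or> (2 \<noteq> i \<and> 2 \<noteq> j)" by arith
    then show ?thesis using that[of 0] that[of 1] that[of 2] two_le_n by linarith
  qed
  show ?thesis
    using tendsto_diff[OF step[OF k(1) ij(1) k(2)] step[OF k(1) ij(2) k(3)]] by simp
qed

end

section \<open>Domination and strict concavity on scalars\<close>

lemma convergent_subsequence_finite_family:
  fixes X :: "'i \<Rightarrow> nat \<Rightarrow> real"
  assumes "finite I" "\<And>i. i \<in> I \<Longrightarrow> bounded (range (X i))"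
  shows "\<exists>s :: nat \<Rightarrow> nat. strict_mono s \<and> (\<forall>i\<in>I. convergent (X i \<circ> s))"
  using assms
proof (induction I rule: finite_induct)
  case empty
  show ?case by (intro exI[of _ "\<lambda>a. a"]) (simp add: strict_mono_def)
next
  case (insert i I)
  then obtain s :: "nat \<Rightarrow> nat" where s: "strict_mono s" "\<forall>i\<in>I. convergent (X i \<circ> s)" by blast
  have "bounded (range (X i \<circ> s))"
    by (rule bounded_subset[OF insert.prems[of i]]) auto
  then obtain l and t :: "nat \<Rightarrow> nat" where t: "strict_mono t" "(X i \<circ> s \<circ> t) \<longlonglongrightarrow> l"
    using bounded_imp_convergent_subsequence by blast
  have "convergent (X j \<circ> (s \<circ> t))" if "j \<in> insert i I" for j
  proof (cases "j = i")
    case True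
    then show ?thesis using t(2) by (auto simp: comp_assoc convergent_def)
  next
    case False
    then have "convergent (X j \<circ> s)" using that s by blast
    then obtain l' where "(X j \<circ> s) \<longlonglongrightarrow> l'" by (auto simp: convergent_def)
    from LIMSEQ_subseq_LIMSEQ[OF this t(1)] show ?thesis
      by (auto simp: comp_assoc convergent_def)
  qed
  then show ?case using strict_mono_o[OF s(1) t(1)] by blast
qed

lemma affinely_dominated_le:
  "affinely_dominated_by n r M \<Longrightarrow> pos_tuple n A \<Longrightarrow> M A \<le>\<^sub>o\<^sub>p (\<Sum>j=1..n. r j *\<^sub>R A j)"
  by (simp add: affinely_dominated_by_def)

lemma affinely_dominated_scalar:
  assumes dom: "affinely_dominated_by n r M" and a: "\<And>j. j \<in> {1..n} \<Longrightarrow> 0 \<le> a j"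
    and x: "norm x = 1"
  shows "inner (blinfun_apply (M (\<lambda>j. a j *\<^sub>R id_blinfun)) x) x \<le> (\<Sum>j=1..n. r j * a j)"
proof -
  have "M (\<lambda>j. a j *\<^sub>R id_blinfun) \<le>\<^sub>o\<^sub>p (\<Sum>j=1..n. r j *\<^sub>R a j *\<^sub>R id_blinfun)"
    by (rule affinely_dominated_le[OF dom pos_tuple_scalar[OF a]])
  then have "M (\<lambda>j. a j *\<^sub>R id_blinfun) \<le>\<^sub>o\<^sub>p (\<Sum>j=1..n. r j * a j) *\<^sub>R id_blinfun"
    by (simp add: scaleR_left.sum)
  from op_le_inner[OF this, of x] show ?thesis
    using x by (simp add: blinfun.scaleR_left norm_1_inner)
qed

text \<open>Downward continuity makes the scalar mean upper semicontinuous, so its gap to the dominating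
  arithmetic mean cannot tend to zero along a sequence that stays away from the diagonal.\<close>

lemma strictly_concave_consensus:
  assumes M: "operator_mean n M" and dom: "affinely_dominated_by n r M"
    and strict: "\<And>a :: nat \<Rightarrow> real. (\<And>k. k \<in> {1..n} \<Longrightarrow> 0 \<le> a k) \<Longrightarrow>
      M (\<lambda>k. a k *\<^sub>R id_blinfun) = (\<Sum>k=1..n. r k * a k) *\<^sub>R id_blinfun \<Longrightarrow>
      (\<forall>i\<in>{1..n}. \<forall>j\<in>{1..n}. a i = a j)"
    and x: "norm x = 1"
    and a: "\<And>m j. j \<in> {1..n} \<Longrightarrow> 0 \<le> a m j" "\<And>m j. j \<in> {1..n} \<Longrightarrow> a m j \<le> C"
    and gap: "(\<lambda>m. (\<Sum>j=1..n. r j * a m j)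
      - inner (blinfun_apply (M (\<lambda>j. a m j *\<^sub>R id_blinfun)) x) x) \<longlonglongrightarrow> 0"
    and ij: "i \<in> {1..n}" "j \<in> {1..n}"
  shows "(\<lambda>m. a m i - a m j) \<longlonglongrightarrow> 0"
proof (rule ccontr)
  define g where "g b = inner (blinfun_apply (M (\<lambda>j. b j *\<^sub>R id_blinfun)) x) x" for b
  assume "\<not> (\<lambda>m. a m i - a m j) \<longlonglongrightarrow> 0"
  then obtain e where e: "0 < e" "\<And>N. \<exists>m\<ge>N. e \<le> \<bar>a m i - a m j\<bar>"
    unfolding LIMSEQ_iff by (force simp: not_less)
  then have inf: "infinite {m. e \<le> \<bar>a m i - a m j\<bar>}"
    unfolding infinite_nat_iff_unbounded_le by auto
  obtain s :: "nat \<Rightarrow> nat" where s: "strict_mono s" "\<And>m. e \<le> \<bar>a (s m) i - a (s m) j\<bar>"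
    using infinite_enumerate[OF inf] by auto
  have "bounded (range (\<lambda>m. a (s m) j))" if "j \<in> {1..n}" for j
    using a[OF that] by (intro boundedI[of _ C]) auto
  then obtain t where t: "strict_mono t" "\<forall>j\<in>{1..n}. convergent ((\<lambda>m. a (s m) j) \<circ> t)"
    using convergent_subsequence_finite_family[of "{1..n}" "\<lambda>j m. a (s m) j"] by auto
  then have "\<forall>j\<in>{1..n}. \<exists>l. (\<lambda>m. a (s (t m)) j) \<longlonglongrightarrow> l"
    by (simp add: convergent_def o_def)
  then obtain b where b: "\<And>j. j \<in> {1..n} \<Longrightarrow> (\<lambda>m. a (s (t m)) j) \<longlonglongrightarrow> b j" by metis
  have b0: "0 \<le> b j" if "j \<in> {1..n}" for j
    by (rule LIMSEQ_le_const[OF b[OF that]]) (use a(1)[OF that] in auto)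
  have gapb: "(\<lambda>m. g (a (s (t m)))) \<longlonglongrightarrow> (\<Sum>j=1..n. r j * b j)"
  proof -
    have "(\<lambda>m. (\<Sum>j=1..n. r j * a (s (t m)) j) - g (a (s (t m)))) \<longlonglongrightarrow> 0"
      using LIMSEQ_subseq_LIMSEQ[OF gap strict_mono_o[OF s(1) t(1)]] by (simp add: g_def o_def)
    moreover have "(\<lambda>m. \<Sum>j=1..n. r j * a (s (t m)) j) \<longlonglongrightarrow> (\<Sum>j=1..n. r j * b j)"
      by (intro tendsto_sum tendsto_mult tendsto_const b)
    ultimately have "(\<lambda>m. (\<Sum>j=1..n. r j * a (s (t m)) j)
        - ((\<Sum>j=1..n. r j * a (s (t m)) j) - g (a (s (t m))))) \<longlonglongrightarrow> (\<Sum>j=1..n. r j * b j) - 0"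
      by (intro tendsto_diff)
    then show ?thesis by simp
  qed
  \<comment> \<open>Continuity is available only from above. Raising the limit \<open>b\<close> by a
    constant d makes it dominate the subsequence eventually, so that monotonicity applies; d then
    decreases to 0.\<close>
  have upper: "(\<Sum>j=1..n. r j * b j) \<le> g (\<lambda>j. b j + d)" if d: "0 < d" for d
  proof (rule tendsto_upperbound[OF gapb])
    have "eventually (\<lambda>m. a (s (t m)) j < b j + d) sequentially" if "j \<in> {1..n}" for j
      using order_tendstoD(2)[OF b[OF that], of "b j + d"] d by simp
    then have "eventually (\<lambda>m. \<forall>j\<in>{1..n}. a (s (t m)) j < b j + d) sequentially"
      by (simp add: eventually_ball_finite)
    then show "eventually (\<lambda>m. g (a (s (t m))) \<le> g (\<lambda>j. b j + d)) sequentially"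
    proof eventually_elim
      case (elim m)
      then show ?case
        unfolding g_def using b0 d a(1)
        by (intro op_le_inner operator_mean_mono[OF M] pos_tuple_scalar op_le_scaleR_id)
          (auto intro: less_imp_le add_nonneg_nonneg)
    qed
  qed simp
  have "(\<lambda>k. M (\<lambda>j. (b j + inverse (real (Suc k))) *\<^sub>R id_blinfun)) \<down>\<^sub>o\<^sub>p M (\<lambda>j. b j *\<^sub>R id_blinfun)"
  proof -
    have cont: "\<forall>X A. (\<forall>k. pos_tuple n (X k)) \<longrightarrow> pos_tuple n A \<longrightarrow>
        (\<forall>j\<in>{1..n}. (\<lambda>k. X k j) \<down>\<^sub>o\<^sub>p A j) \<longrightarrow> (\<lambda>k. M (X k)) \<down>\<^sub>o\<^sub>p M A"
      using M by (simp add: operator_mean_def)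
    have dec: "(\<lambda>k. (c + inverse (real (Suc k))) *\<^sub>R id_blinfun) \<down>\<^sub>o\<^sub>p c *\<^sub>R (id_blinfun :: 'a \<Rightarrow>\<^sub>L 'a)" for c
    proof -
      have "(\<lambda>k. (c + inverse (real (Suc k))) *\<^sub>R y) \<longlonglongrightarrow> (c + 0) *\<^sub>R y" for y :: 'a
        by (intro tendsto_intros LIMSEQ_inverse_real_of_nat)
      moreover have "(c + inverse (real (Suc (Suc k)))) *\<^sub>R id_blinfun
          \<le>\<^sub>o\<^sub>p (c + inverse (real (Suc k))) *\<^sub>R (id_blinfun :: 'a \<Rightarrow>\<^sub>L 'a)" for k
        by (intro op_le_scaleR_id) (simp add: field_simps)
      ultimately show ?thesis by (simp add: op_decreases_to_def blinfun.scaleR_left)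
    qed
    show ?thesis
      by (rule cont[rule_format]) (auto intro!: pos_tuple_scalar dec add_nonneg_nonneg b0 simp del: of_nat_Suc)
  qed
  then have "(\<lambda>k. g (\<lambda>j. b j + inverse (real (Suc k)))) \<longlonglongrightarrow> g b"
    unfolding op_decreases_to_def g_def by (intro tendsto_inner tendsto_const) blast
  then have "(\<Sum>j=1..n. r j * b j) \<le> g b"
    by (rule LIMSEQ_le_const) (use upper in auto)
  moreover have "g b \<le> (\<Sum>j=1..n. r j * b j)"
    unfolding g_def by (rule affinely_dominated_scalar[OF dom b0 x])
  ultimately have gb: "g b = (\<Sum>j=1..n. r j * b j)" by (rule order_antisym[rotated])
  \<comment> \<open>The mean of scalars is a scalar, so the equality of numbers at \<open>x\<close>
    becomes the operator equality demanded by strictness.\<close>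
  obtain c where c: "M (\<lambda>j. b j *\<^sub>R id_blinfun) = c *\<^sub>R id_blinfun"
    using operator_mean_scalar[OF M, of b] b0 by blast
  have "g b = c"
    using x by (simp add: g_def c blinfun.scaleR_left norm_1_inner)
  then have "M (\<lambda>j. b j *\<^sub>R id_blinfun) = (\<Sum>j=1..n. r j * b j) *\<^sub>R id_blinfun"
    unfolding c gb by (rule arg_cong[OF sym])
  from strict[OF b0 this] have "b i = b j" using ij by blast
  then have "(\<lambda>m. \<bar>a (s (t m)) i - a (s (t m)) j\<bar>) \<longlonglongrightarrow> 0"
    using tendsto_rabs[OF tendsto_diff[OF b[OF ij(1)] b[OF ij(2)]]] by simp
  then have "e \<le> 0"
    by (rule LIMSEQ_le_const) (use s(2) in auto)
  with e(1) show False by simp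
qed


section \<open>The Kubo-Ando correspondence on scalars\<close>

text \<open>The description defining \<open>op_fun\<close> quantifies over all approximating
  sequences; one of them must exist for it to single out an operator.\<close>

lemma uniform_limit_polynomials:
  fixes f :: "real \<Rightarrow> real"
  assumes "compact S" "continuous_on S f"
  shows "\<exists>p :: nat \<Rightarrow> real poly. uniform_limit S (\<lambda>k. poly (p k)) f sequentially"
proof -
  have "\<exists>p. \<forall>x\<in>S. \<bar>f x - poly p x\<bar> < inverse (real (Suc k))" for k
  proof -
    obtain g where g: "real_polynomial_function g" "\<And>x. x \<in> S \<Longrightarrow> \<bar>f x - g x\<bar> < inverse (real (Suc k))"
      using Stone_Weierstrass_real_polynomial_function[OF assms, of "inverse (real (Suc k))"] by auto
    then obtain a m where "g = (\<lambda>x. \<Sum>i\<le>m. a i * x ^ i)"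
      using real_polynomial_function_imp_sum by blast
    then have "g x = poly (\<Sum>i\<le>(m::nat). Polynomial.monom (a i) i) x" for x
      by (simp add: poly_sum poly_monom)
    with g(2) show ?thesis by metis
  qed
  then obtain p where p: "\<And>k x. x \<in> S \<Longrightarrow> \<bar>f x - poly (p k) x\<bar> < inverse (real (Suc k))" by metis
  have "uniform_limit S (\<lambda>k. poly (p k)) f sequentially"
  proof (rule uniform_limitI)
    fix e :: real assume "0 < e"
    then have "eventually (\<lambda>k. inverse (real (Suc k)) < e) sequentially"
      using order_tendstoD(2)[OF LIMSEQ_inverse_real_of_nat] by blast
    then show "eventually (\<lambda>k. \<forall>x\<in>S. dist (poly (p k) x) (f x) < e) sequentially"
    proof eventually_elim
      case (elim k)
      then show ?case using p[of _ k] by (auto simp: dist_real_def abs_minus_commute intro: less_trans)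
    qed
  qed
  then show ?thesis by blast
qed

lemma op_poly_scalar: "op_poly p (t *\<^sub>R id_blinfun) = poly p t *\<^sub>R id_blinfun"
proof -
  have "(((o\<^sub>L) (t *\<^sub>R id_blinfun)) ^^ i) id_blinfun = t ^ i *\<^sub>R (id_blinfun :: 'a \<Rightarrow>\<^sub>L 'a)" for i
    by (induction i) (auto intro!: blinfun_eqI simp: blinfun.scaleR_left blinfun.scaleR_right)
  then show ?thesis by (simp add: op_poly_def poly_altdef scaleR_left.sum)
qed

lemma op_fun_scalar:
  assumes f: "continuous_on {0..} f" and t: "0 \<le> t" and x: "norm (x :: 'a::chilbert_space) = 1"
  shows "op_fun f (t *\<^sub>R (id_blinfun :: 'a \<Rightarrow>\<^sub>L 'a)) = f t *\<^sub>R id_blinfun"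
proof -
  let ?A = "t *\<^sub>R (id_blinfun :: 'a \<Rightarrow>\<^sub>L 'a)"
  \<comment> \<open>The unit vector places \<open>t\<close> in the interval of approximation; on the
    zero space the norm would be 0.\<close>
  have "t \<le> norm ?A"
    using norm_blinfun[of ?A x] t x by (simp add: blinfun.scaleR_left)
  then have lim: "(\<lambda>k. op_poly (p k) ?A) \<longlonglongrightarrow> f t *\<^sub>R id_blinfun"
    if "uniform_limit {0..norm ?A} (\<lambda>k. poly (p k)) f sequentially" for p
    unfolding op_poly_scalar using t
    by (intro tendsto_scaleR tendsto_const tendsto_uniform_limitI[OF that]) auto
  obtain p where p: "uniform_limit {0..norm ?A} (\<lambda>k. poly (p k)) f sequentially"
    using uniform_limit_polynomials[of "{0..norm ?A}" f] continuous_on_subset[OF f] by fastforce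
  show ?thesis
    unfolding op_fun_def
  proof (rule the_equality)
    show "\<forall>p. uniform_limit {0..norm ?A} (\<lambda>k. poly (p k)) f sequentially \<longrightarrow>
        (\<lambda>k. op_poly (p k) ?A) \<longlonglongrightarrow> f t *\<^sub>R id_blinfun"
      using lim by blast
    show "T = f t *\<^sub>R id_blinfun" if "\<forall>p. uniform_limit {0..norm ?A} (\<lambda>k. poly (p k)) f sequentially \<longrightarrow>
        (\<lambda>k. op_poly (p k) ?A) \<longlonglongrightarrow> T" for T
      using that p lim[OF p] LIMSEQ_unique by blast
  qed
qed

lemma op_sqrt_id: "op_sqrt (id_blinfun :: 'a::chilbert_space \<Rightarrow>\<^sub>L 'a) = id_blinfun"
  unfolding op_sqrt_def
proof (rule the_equality)
  show "positive_op (id_blinfun :: 'a \<Rightarrow>\<^sub>L 'a) \<and> id_blinfun o\<^sub>L id_blinfun = (id_blinfun :: 'a \<Rightarrow>\<^sub>L 'a)"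
    by (auto simp: positive_op_id intro: blinfun_eqI)
  fix R :: "'a \<Rightarrow>\<^sub>L 'a" assume R: "positive_op R \<and> R o\<^sub>L R = id_blinfun"
  show "R = id_blinfun"
  proof (rule blinfun_eqI)
    fix x
    \<comment> \<open>An involution acts on this vector as -1, which positivity permits only for the
      zero vector.\<close>
    let ?y = "blinfun_apply R x - x"
    have "blinfun_apply R (blinfun_apply R x) = x"
      using R by (metis blinfun_apply_blinfun_compose id_blinfun.rep_eq)
    then have "blinfun_apply R ?y = - ?y" by (simp add: blinfun.diff_right)
    moreover have "0 \<le> inner (blinfun_apply R ?y) ?y" using R positive_op_inner_nonneg by blast
    ultimately have "inner ?y ?y \<le> 0" by (simp only: inner_minus_left)
    then have "?y = 0" by (metis inner_eq_zero_iff inner_ge_zero order_antisym)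
    then show "blinfun_apply R x = blinfun_apply id_blinfun x" by simp
  qed
qed

lemma blinfun_compose_id: "A o\<^sub>L id_blinfun = A" "id_blinfun o\<^sub>L A = A"
  by (auto intro: blinfun_eqI)

lemma op_inverse_id: "op_inverse id_blinfun = id_blinfun"
  unfolding op_inverse_def by (rule the_equality) (auto simp: blinfun_compose_id)

lemma kubo_ando_scalar:
  assumes KA: "kubo_ando_correspondence TYPE('a)" and \<sigma>: "operator_mean 2 \<sigma>"
    and x: "norm (x :: 'a::chilbert_space) = 1"
  shows "\<exists>f. operator_monotone f \<and> (\<forall>t>0. 0 < f t) \<and> f 1 = 1 \<and> continuous_on {0..} f \<and>
    (\<forall>t\<ge>0. \<sigma> (\<lambda>j. if j = 1 then id_blinfun else t *\<^sub>R id_blinfun) = f t *\<^sub>R (id_blinfun :: 'a \<Rightarrow>\<^sub>L 'a))"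
proof -
  obtain f where f: "operator_monotone f" "\<forall>t>0. 0 < f t" "f 1 = 1" "continuous_on {0..} f"
    and rep: "\<And>A B. positive_op A \<Longrightarrow> invertible_op A \<Longrightarrow> positive_op B \<Longrightarrow>
      (let R = op_sqrt A; R' = op_inverse R in
        \<sigma> (\<lambda>j. if j = 1 then A else B) = R o\<^sub>L op_fun f (R' o\<^sub>L B o\<^sub>L R') o\<^sub>L R)"
    using KA \<sigma> unfolding kubo_ando_correspondence_def by metis
  have inv: "invertible_op (id_blinfun :: 'a \<Rightarrow>\<^sub>L 'a)"
    by (auto simp: invertible_op_def blinfun_compose_id)
  have "\<sigma> (\<lambda>j. if j = 1 then id_blinfun else t *\<^sub>R id_blinfun) = f t *\<^sub>R id_blinfun" if "0 \<le> t" for t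
    using rep[OF positive_op_id inv positive_op_scaleR[OF positive_op_id that]]
    by (simp add: Let_def op_sqrt_id op_inverse_id blinfun_compose_id op_fun_scalar[OF f(4) that x])
  with f show ?thesis by blast
qed

text \<open>Isolating one slot brings a mean of \<open>n\<close> variables within reach of the
  two-variable correspondence.\<close>

lemma operator_mean_slot:
  assumes M: "operator_mean n M"
  shows "operator_mean 2 (\<lambda>B. M (\<lambda>i. if i = j then B 1 else B 2))"
proof -
  have pt: "pos_tuple n (\<lambda>i. if i = j then B 1 else B 2)" if "pos_tuple 2 B" for B :: "nat \<Rightarrow> 'a \<Rightarrow>\<^sub>L 'a"
    using that by (simp add: pos_tuple_def)
  show ?thesis
    unfolding operator_mean_def
  proof (intro conjI allI impI)
    fix A :: "nat \<Rightarrow> 'a \<Rightarrow>\<^sub>L 'a" assume A: "pos_tuple 2 A"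
    then show "positive_op (M (\<lambda>i. if i = j then A 1 else A 2))"
      by (intro operator_mean_positive[OF M] pt)
    show "M (\<lambda>i. if i = j then A 1 else A 2) \<le>\<^sub>o\<^sub>p M (\<lambda>i. if i = j then B 1 else B 2)"
      if "pos_tuple 2 B" "\<forall>j\<in>{1..2}. A j \<le>\<^sub>o\<^sub>p B j" for B
      using A that by (intro operator_mean_mono[OF M] pt) auto
    show "S o\<^sub>L M (\<lambda>i. if i = j then A 1 else A 2) o\<^sub>L S
        \<le>\<^sub>o\<^sub>p M (\<lambda>i. if i = j then S o\<^sub>L A 1 o\<^sub>L S else S o\<^sub>L A 2 o\<^sub>L S)" if "positive_op S" for S
    proof -
      have "(\<lambda>i. S o\<^sub>L (if i = j then A 1 else A 2) o\<^sub>L S)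
          = (\<lambda>i. if i = j then S o\<^sub>L A 1 o\<^sub>L S else S o\<^sub>L A 2 o\<^sub>L S)" by auto
      then show ?thesis using operator_mean_transformer[OF M pt[OF A] that] by simp
    qed
    show "(\<lambda>k. M (\<lambda>i. if i = j then X k 1 else X k 2)) \<down>\<^sub>o\<^sub>p M (\<lambda>i. if i = j then A 1 else A 2)"
      if "\<forall>k. pos_tuple 2 (X k)" "\<forall>j\<in>{1..2}. (\<lambda>k. X k j) \<down>\<^sub>o\<^sub>p A j" for X
    proof -
      have "(\<forall>k. pos_tuple n (Y k)) \<Longrightarrow> pos_tuple n B \<Longrightarrow>
          (\<forall>j\<in>{1..n}. (\<lambda>k. Y k j) \<down>\<^sub>o\<^sub>p B j) \<Longrightarrow> (\<lambda>k. M (Y k)) \<down>\<^sub>o\<^sub>p M B" for Y B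
        using M by (simp add: operator_mean_def)
      from this[of "\<lambda>k i. if i = j then X k 1 else X k 2" "\<lambda>i. if i = j then A 1 else A 2"]
      show ?thesis using that A pt by auto
    qed
  next
    show "M (\<lambda>i. if i = j then id_blinfun else id_blinfun) = id_blinfun"
      using M by (simp add: operator_mean_def)
  qed
qed

text \<open>The representing function of the slot mean lies below r_j + (1 - r_j) t by domination.
  The resulting harmonic bound has the same tangent at t = 1 and so pins down the derivative
  there.\<close>

lemma operator_mean_slot_harmonic:
  assumes KA: "kubo_ando_correspondence TYPE('a::chilbert_space)" and M: "operator_mean n M"
    and dom: "affinely_dominated_by n r M" and j: "j \<in> {1..n}" and x: "norm (x :: 'a) = 1" and t: "0 < t"
  shows "1 / (r j + (1 - r j) / t)
    \<le> inner (blinfun_apply (M (\<lambda>i. (if i = j then 1 else t) *\<^sub>R id_blinfun)) x) x"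
proof -
  obtain f where f: "operator_monotone f" "\<And>t. 0 < t \<Longrightarrow> 0 < f t" "f 1 = 1" "continuous_on {0..} f"
    and rep: "\<And>t. 0 \<le> t \<Longrightarrow> M (\<lambda>i. if i = j then id_blinfun else t *\<^sub>R id_blinfun)
      = f t *\<^sub>R (id_blinfun :: 'a \<Rightarrow>\<^sub>L 'a)"
    using kubo_ando_scalar[OF KA operator_mean_slot[OF M, of j] x] by (auto cong: if_cong)
  have eq: "(\<lambda>i. (if i = j then 1 else t) *\<^sub>R id_blinfun)
      = (\<lambda>i. if i = j then id_blinfun else t *\<^sub>R (id_blinfun :: 'a \<Rightarrow>\<^sub>L 'a))" for t by auto
  have val: "inner (blinfun_apply (M (\<lambda>i. (if i = j then 1 else t) *\<^sub>R id_blinfun)) x) x = f t"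
    if "0 < t" for t
    unfolding eq using that x by (simp add: rep blinfun.scaleR_left norm_1_inner)
  have "f t \<le> r j + (1 - r j) * t" if "0 < t" for t
  proof -
    have "f t \<le> (\<Sum>i=1..n. r i * (if i = j then 1 else t))"
      using affinely_dominated_scalar[OF dom _ x, of "\<lambda>i. if i = j then 1 else t"] that
      by (simp only: val) auto
    also have "\<dots> = (\<Sum>i=1..n. r i * t + (if i = j then r i * (1 - t) else 0))"
      by (intro sum.cong) (auto simp: algebra_simps)
    also have "\<dots> = t + r j * (1 - t)"
      using dom j by (simp add: sum.distrib affinely_dominated_by_def flip: sum_distrib_right)
    finally show ?thesis by (simp add: algebra_simps)
  qed
  moreover have "0 < r j" "r j < 1" using dom j by (auto simp: affinely_dominated_by_def)
  ultimately show ?thesis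
    using operator_monotone_harmonic_le[OF f(1,2,4) _ _ _ f(3) t] by (simp only: val[OF t])
qed

text \<open>The transformer inequality at the identity tuple, with \<open>sqrt t\<close> times the
  identity as multiplier.\<close>

lemma operator_mean_const_ge:
  fixes M :: "(nat \<Rightarrow> 'a::chilbert_space \<Rightarrow>\<^sub>L 'a) \<Rightarrow> 'a \<Rightarrow>\<^sub>L 'a"
  assumes M: "operator_mean n M" and t: "0 \<le> t"
  shows "t *\<^sub>R id_blinfun \<le>\<^sub>o\<^sub>p M (\<lambda>i. t *\<^sub>R id_blinfun)"
proof -
  let ?S = "sqrt t *\<^sub>R (id_blinfun :: 'a \<Rightarrow>\<^sub>L 'a)"
  have S: "?S o\<^sub>L id_blinfun o\<^sub>L ?S = t *\<^sub>R id_blinfun"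
    using t by (intro blinfun_eqI) (simp add: blinfun.scaleR_left)
  have "M (\<lambda>j. id_blinfun) = id_blinfun" using M by (simp add: operator_mean_def)
  then show ?thesis
    using operator_mean_transformer[OF M, of "\<lambda>j. id_blinfun" ?S] t
    by (simp add: S pos_tuple_def positive_op_id positive_op_scaleR)
qed


section \<open>Cyclic iterations of means\<close>

text \<open>The shift by \<open>k\<close> is a bijection from the slots onto the indices other than
  \<open>k\<close>; the four claims are those of a reindexing with explicit inverse. Adding n + 1
  first keeps the natural subtraction from truncating.\<close>

lemma cyclic_shift:
  assumes "k \<le> (n::nat)"
  shows "j \<in> {1..n} \<Longrightarrow> (k + j) mod (n + 1) \<in> {..n} - {k}"
    and "j \<in> {1..n} \<Longrightarrow> ((k + j) mod (n + 1) + (n + 1) - k) mod (n + 1) = j"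
    and "l \<in> {..n} - {k} \<Longrightarrow> (l + (n + 1) - k) mod (n + 1) \<in> {1..n}"
    and "l \<in> {..n} - {k} \<Longrightarrow> (k + (l + (n + 1) - k) mod (n + 1)) mod (n + 1) = l"
proof -
  have 1: "(k + j) mod (n + 1) = (if k + j \<le> n then k + j else k + j - (n + 1))" if "j \<in> {1..n}" for j
    using assms that by (auto simp: mod_if)
  have 2: "(l + (n + 1) - k) mod (n + 1) = (if k < l then l - k else l + (n + 1) - k)"
    if "l \<in> {..n} - {k}" for l
    using assms that by (auto simp: mod_if)
  show A: "(k + j) mod (n + 1) \<in> {..n} - {k}" if "j \<in> {1..n}" for j
    using assms that unfolding 1[OF that] by auto
  show "((k + j) mod (n + 1) + (n + 1) - k) mod (n + 1) = j" if "j \<in> {1..n}" for j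
    using assms that unfolding 2[OF A[OF that]] unfolding 1[OF that] by auto
  show B: "(l + (n + 1) - k) mod (n + 1) \<in> {1..n}" if "l \<in> {..n} - {k}" for l
    using assms that unfolding 2[OF that] by auto
  show "(k + (l + (n + 1) - k) mod (n + 1)) mod (n + 1) = l" if "l \<in> {..n} - {k}" for l
    using assms that unfolding 1[OF B[OF that]] unfolding 2[OF that] by auto
qed

locale cyclic_means =
  fixes n :: nat and M :: "nat \<Rightarrow> (nat \<Rightarrow> 'a::chilbert_space \<Rightarrow>\<^sub>L 'a) \<Rightarrow> 'a \<Rightarrow>\<^sub>L 'a"
    and r :: "nat \<Rightarrow> nat \<Rightarrow> real"
  assumes n2: "2 \<le> n"
    and mean: "k \<le> n \<Longrightarrow> operator_mean n (M k)"
    and dom: "k \<le> n \<Longrightarrow> affinely_dominated_by n (r k) (M k)"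
begin

definition w :: "nat \<Rightarrow> nat \<Rightarrow> real" where
  "w k l = (if l = k then 0 else r k ((l + (n + 1) - k) mod (n + 1)))"

text \<open>Stated over an arbitrary real vector space so as to serve for operators and for numbers
  alike.\<close>

lemma w_sum:
  fixes B :: "nat \<Rightarrow> 'b::real_vector"
  assumes k: "k \<le> n"
  shows "(\<Sum>j=1..n. r k j *\<^sub>R B ((k + j) mod (n + 1))) = (\<Sum>l\<le>n. w k l *\<^sub>R B l)"
proof -
  have "(\<Sum>j=1..n. r k j *\<^sub>R B ((k + j) mod (n + 1))) = (\<Sum>l\<in>{..n} - {k}. w k l *\<^sub>R B l)"
  proof (rule sum.reindex_bij_witness[where j = "\<lambda>j. (k + j) mod (n + 1)"
        and i = "\<lambda>l. (l + (n + 1) - k) mod (n + 1)"])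
    fix j assume j: "j \<in> {1..n}"
    show "w k ((k + j) mod (n + 1)) *\<^sub>R B ((k + j) mod (n + 1)) = r k j *\<^sub>R B ((k + j) mod (n + 1))"
      using cyclic_shift(1,2)[OF k j] by (simp add: w_def)
  qed (fact cyclic_shift[OF k])+
  also have "\<dots> = (\<Sum>l\<le>n. w k l *\<^sub>R B l)"
    by (rule sum.mono_neutral_left) (auto simp: w_def)
  finally show ?thesis .
qed

sublocale offdiag_stochastic n w
proof
  show "(\<Sum>l\<le>n. w k l) = 1" if "k \<le> n" for k
    using w_sum[OF that, of "\<lambda>_. 1 :: real"] dom[OF that] by (simp add: affinely_dominated_by_def)
  show "0 < w k l" if "k \<le> n" "l \<le> n" "k \<noteq> l" for k l
    using cyclic_shift(3)[OF that(1), of l] that dom[OF that(1)]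
    by (auto simp: w_def affinely_dominated_by_def)
qed (use n2 in \<open>auto simp: w_def\<close>)

lemma shifted_dominated:
  assumes k: "k \<le> n" and B: "\<And>l. l \<le> n \<Longrightarrow> positive_op (B l)"
  shows "M k (\<lambda>j. B ((k + j) mod (n + 1))) \<le>\<^sub>o\<^sub>p (\<Sum>l\<le>n. w k l *\<^sub>R B l)"
proof -
  have "pos_tuple n (\<lambda>j. B ((k + j) mod (n + 1)))"
    unfolding pos_tuple_def using B by (auto simp: less_Suc_eq_le[symmetric])
  from affinely_dominated_le[OF dom[OF k] this] show ?thesis
    by (simp only: w_sum[OF k])
qed

lemma iteration_positive:
  assumes "\<And>k. k \<le> n \<Longrightarrow> positive_op (A k)" "k \<le> n"
  shows "positive_op (mean_iteration n M A m k)"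
  using assms(2)
proof (induction m arbitrary: k)
  case (Suc m)
  show ?case
    unfolding mean_iteration.simps
    by (rule operator_mean_positive[OF mean[OF Suc.prems]])
      (auto simp: pos_tuple_def less_Suc_eq_le[symmetric] intro!: Suc.IH)
qed (use assms(1) in simp)

lemma iteration_dominated:
  assumes "\<And>k. k \<le> n \<Longrightarrow> positive_op (A k)" "k \<le> n"
  shows "mean_iteration n M A (Suc m) k \<le>\<^sub>o\<^sub>p (\<Sum>l\<le>n. w k l *\<^sub>R mean_iteration n M A m l)"
  unfolding mean_iteration.simps
  by (rule shifted_dominated[OF assms(2) iteration_positive[OF assms(1)]])

lemma stationary_sum_scaleR:
  fixes B :: "nat \<Rightarrow> 'b::real_vector"
  assumes "stationary p"
  shows "(\<Sum>k\<le>n. p k *\<^sub>R (\<Sum>l\<le>n. w k l *\<^sub>R B l)) = (\<Sum>l\<le>n. p l *\<^sub>R B l)"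
proof -
  have "(\<Sum>k\<le>n. p k *\<^sub>R (\<Sum>l\<le>n. w k l *\<^sub>R B l)) = (\<Sum>l\<le>n. \<Sum>k\<le>n. (p k * w k l) *\<^sub>R B l)"
    by (subst sum.swap) (simp add: scaleR_sum_right)
  also have "\<dots> = (\<Sum>l\<le>n. p l *\<^sub>R B l)"
    using assms by (intro sum.cong) (auto simp: stationary_def simp flip: scaleR_left.sum)
  finally show ?thesis .
qed

lemma weighted_sum_decreasing:
  assumes p: "stationary p" "\<And>k. k \<le> n \<Longrightarrow> 0 < p k" and A: "\<And>k. k \<le> n \<Longrightarrow> positive_op (A k)"
  shows "(\<Sum>k\<le>n. p k *\<^sub>R mean_iteration n M A (Suc m) k) \<le>\<^sub>o\<^sub>p (\<Sum>k\<le>n. p k *\<^sub>R mean_iteration n M A m k)"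
proof -
  have "(\<Sum>k\<le>n. p k *\<^sub>R mean_iteration n M A m k) - (\<Sum>k\<le>n. p k *\<^sub>R mean_iteration n M A (Suc m) k)
      = (\<Sum>k\<le>n. p k *\<^sub>R ((\<Sum>l\<le>n. w k l *\<^sub>R mean_iteration n M A m l) - mean_iteration n M A (Suc m) k))"
    by (simp only: scaleR_diff_right sum_subtractf stationary_sum_scaleR[OF p(1)])
  moreover have "positive_op (\<Sum>k\<le>n. p k *\<^sub>R ((\<Sum>l\<le>n. w k l *\<^sub>R mean_iteration n M A m l) - mean_iteration n M A (Suc m) k))"
    using iteration_dominated[where A = A, OF A] p(2)
    by (intro positive_op_sum positive_op_scaleR) (auto simp: op_le_def intro: less_imp_le simp del: mean_iteration.simps)
  ultimately show ?thesis unfolding op_le_def by simp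
qed

text \<open>The weighted average of the quadratic forms converges to that of \<open>S\<close>, and
  by consensus each single form differs from the average by a null sequence.\<close>

lemma iteration_converges:
  assumes p: "stationary p" "\<And>k. k \<le> n \<Longrightarrow> 0 < p k" "(\<Sum>k\<le>n. p k) = 1"
    and A: "\<And>k. k \<le> n \<Longrightarrow> positive_op (A k)"
    and consensus: "\<And>x i j. i \<le> n \<Longrightarrow> j \<le> n \<Longrightarrow>
      (\<lambda>m. inner (blinfun_apply (mean_iteration n M A m i) x) x
        - inner (blinfun_apply (mean_iteration n M A m j) x) x) \<longlonglongrightarrow> 0"
  shows "\<exists>S\<in>bounded_operators. (\<forall>k\<le>n. wot_tendsto (\<lambda>m. mean_iteration n M A m k) S) \<and>
    (\<lambda>m. \<Sum>k\<le>n. p k *\<^sub>R mean_iteration n M A m k) \<down>\<^sub>o\<^sub>p S"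
proof -
  define Y where "Y m = (\<Sum>k\<le>n. p k *\<^sub>R mean_iteration n M A m k)" for m
  have Ypos: "positive_op (Y m)" for m
    unfolding Y_def using p(2) iteration_positive[where A = A, OF A]
    by (intro positive_op_sum positive_op_scaleR) (auto intro: less_imp_le)
  have "Y (Suc m) \<le>\<^sub>o\<^sub>p Y m" for m
    unfolding Y_def by (rule weighted_sum_decreasing[where A = A, OF p(1,2) A])
  from decreasing_positive_op_converges[of Y, OF Ypos this]
  obtain S where S: "S \<in> bounded_operators" "Y \<down>\<^sub>o\<^sub>p S" by blast
  have "wot_tendsto (\<lambda>m. mean_iteration n M A m k) S" if k: "k \<le> n" for k
  proof (rule wot_tendsto_quadratic_form[where Y = Y, OF iteration_positive[where A = A, OF A k] S(2) Ypos])
    fix x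
    define q where "q m l = inner (blinfun_apply (mean_iteration n M A m l) x) x" for m l
    have "(\<lambda>m. inner (blinfun_apply (Y m) x) x) \<longlonglongrightarrow> inner (blinfun_apply S x) x"
      using S(2) unfolding op_decreases_to_def by (intro tendsto_inner tendsto_const) blast
    moreover have "inner (blinfun_apply (Y m) x) x = (\<Sum>l\<le>n. p l * q m l)" for m
      by (simp add: Y_def q_def blinfun.sum_left blinfun.scaleR_left inner_sum_left)
    ultimately have 1: "(\<lambda>m. \<Sum>l\<le>n. p l * q m l) \<longlonglongrightarrow> inner (blinfun_apply S x) x" by simp
    have "(\<lambda>m. \<Sum>l\<le>n. p l * (q m k - q m l)) \<longlonglongrightarrow> (\<Sum>l\<le>n. p l * 0)"
      unfolding q_def using k by (intro tendsto_sum tendsto_mult tendsto_const consensus) auto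
    from tendsto_add[OF this 1]
    have "(\<lambda>m. (\<Sum>l\<le>n. p l * (q m k - q m l)) + (\<Sum>l\<le>n. p l * q m l))
        \<longlonglongrightarrow> inner (blinfun_apply S x) x" by simp
    moreover have "(\<Sum>l\<le>n. p l * (q m k - q m l)) + (\<Sum>l\<le>n. p l * q m l) = (\<Sum>l\<le>n. p l) * q m k" for m
      by (simp add: sum_distrib_right right_diff_distrib sum_subtractf)
    ultimately have "(\<lambda>m. (\<Sum>l\<le>n. p l) * q m k) \<longlonglongrightarrow> inner (blinfun_apply S x) x"
      by (simp only:)
    then show "(\<lambda>m. inner (blinfun_apply (mean_iteration n M A m k) x) x) \<longlonglongrightarrow> inner (blinfun_apply S x) x"
      by (simp add: p(3) q_def)
  qed
  then show ?thesis using S unfolding Y_def by blast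
qed

section \<open>Consensus of the quadratic forms\<close>

lemma arithmetic_consensus:
  assumes p: "stationary p" "\<And>k. k \<le> n \<Longrightarrow> 0 < p k"
    and arith: "\<And>k B. k \<le> n \<Longrightarrow> pos_tuple n B \<Longrightarrow> M k B = (\<Sum>j=1..n. r k j *\<^sub>R B j)"
    and A: "\<And>k. k \<le> n \<Longrightarrow> positive_op (A k)" and ij: "i \<le> n" "j \<le> n"
  shows "(\<lambda>m. inner (blinfun_apply (mean_iteration n M A m i) x) x
    - inner (blinfun_apply (mean_iteration n M A m j) x) x) \<longlonglongrightarrow> 0"
proof (rule linear_consensus[OF p _ ij])
  fix m k assume k: "k \<le> n"
  have "pos_tuple n (\<lambda>j. mean_iteration n M A m ((k + j) mod (n + 1)))"
    by (auto simp: pos_tuple_def less_Suc_eq_le[symmetric] intro!: iteration_positive A)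
  then have "mean_iteration n M A (Suc m) k = (\<Sum>l\<le>n. w k l *\<^sub>R mean_iteration n M A m l)"
    unfolding mean_iteration.simps by (simp only: arith[OF k] w_sum[OF k])
  then show "inner (blinfun_apply (mean_iteration n M A (Suc m) k) x) x
      = (\<Sum>l\<le>n. w k l * inner (blinfun_apply (mean_iteration n M A m l) x) x)"
    by (simp only: blinfun.sum_left blinfun.scaleR_left inner_sum_left inner_scaleR_left)
qed

text \<open>The next state of index \<open>k\<close> lies below the scalar mean of the current
  states, which lies below their arithmetic mean. Since the outer gap vanishes in the limit, so does
  the inner one. Only indices other than \<open>k\<close> enter \<open>M k\<close>, hence the
  restriction on \<open>i\<close> and \<open>j\<close>.\<close>

lemma strict_consensus_unit:
  assumes p: "stationary p" "\<And>k. k \<le> n \<Longrightarrow> 0 < p k"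
    and k: "k \<le> n" and strict: "\<And>a :: nat \<Rightarrow> real. (\<And>j. j \<in> {1..n} \<Longrightarrow> 0 \<le> a j) \<Longrightarrow>
      M k (\<lambda>j. a j *\<^sub>R id_blinfun) = (\<Sum>j=1..n. r k j * a j) *\<^sub>R id_blinfun \<Longrightarrow>
      (\<forall>i\<in>{1..n}. \<forall>j\<in>{1..n}. a i = a j)"
    and A: "\<And>k. k \<le> n \<Longrightarrow> positive_op (A k)"
    and ij: "i \<in> {..n} - {k}" "j \<in> {..n} - {k}" and x: "norm x = 1"
  shows "(\<lambda>m. inner (blinfun_apply (mean_iteration n M A m i) x) x
    - inner (blinfun_apply (mean_iteration n M A m j) x) x) \<longlonglongrightarrow> 0"
proof -
  define q where "q m l = inner (blinfun_apply (mean_iteration n M A m l) x) x" for m l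
  define a where "a m j = q m ((k + j) mod (n + 1))" for m j
  define g where "g m = inner (blinfun_apply (M k (\<lambda>j. a m j *\<^sub>R id_blinfun)) x) x" for m
  have q0: "0 \<le> q m l" if "l \<le> n" for m l
    unfolding q_def using positive_op_inner_nonneg[OF iteration_positive[where A = A, OF A that]] .
  have qdom: "q (Suc m) l \<le> (\<Sum>i\<le>n. w l i * q m i)" if "l \<le> n" for m l
    using op_le_inner[OF iteration_dominated[where A = A, OF A that], where x = x]
    by (simp only: q_def blinfun.sum_left blinfun.scaleR_left inner_sum_left inner_scaleR_left)
  have Y: "(\<Sum>l\<le>n. p l * q m l) \<le> (\<Sum>l\<le>n. p l * q 0 l)" for m
  proof (induction m)
    case (Suc m)
    have "(\<Sum>l\<le>n. p l * q (Suc m) l) \<le> (\<Sum>l\<le>n. p l * (\<Sum>i\<le>n. w l i * q m i))"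
      using qdom p(2) by (intro sum_mono mult_left_mono) (auto intro: less_imp_le)
    also have "\<dots> = (\<Sum>l\<le>n. p l * q m l)" by (rule stationary_sum[OF p(1)])
    finally show ?case using Suc.IH by simp
  qed simp
  \<comment> \<open>Each term of the weighted sum is at most its initial value, so dividing by
    \<open>p l\<close> bounds the l-th state; adding these bounds makes one that serves all
    indices.\<close>
  define C where "C = (\<Sum>l\<le>n. (\<Sum>i\<le>n. p i * q 0 i) / p l)"
  have Y0: "0 \<le> (\<Sum>i\<le>n. p i * q 0 i)"
    using p(2) q0 by (intro sum_nonneg mult_nonneg_nonneg) (auto intro: less_imp_le)
  have qC: "q m l \<le> C" if l: "l \<le> n" for m l
  proof -
    have "p l * q m l \<le> (\<Sum>i\<le>n. p i * q m i)"
      using p(2) q0 l by (intro member_le_sum mult_nonneg_nonneg) (auto intro: less_imp_le)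
    then have "q m l \<le> (\<Sum>i\<le>n. p i * q 0 i) / p l"
      using Y[of m] p(2)[OF l] by (simp add: pos_le_divide_eq mult.commute)
    also have "\<dots> \<le> C"
      unfolding C_def using p(2) Y0 l
      by (intro member_le_sum[where f = "\<lambda>l. (\<Sum>i\<le>n. p i * q 0 i) / p l"] divide_nonneg_nonneg)
        (auto intro: less_imp_le)
    finally show ?thesis .
  qed
  have mod: "(k + j) mod (n + 1) \<le> n" for j by (simp add: less_Suc_eq_le[symmetric])
  have a0: "0 \<le> a m j" and aC: "a m j \<le> C" for m j
    using q0[OF mod] qC[OF mod] by (simp_all add: a_def)
  have asum: "(\<Sum>j=1..n. r k j * a m j) = (\<Sum>l\<le>n. w k l * q m l)" for m
    using w_sum[OF k, of "q m"] by (simp add: a_def)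
  have le: "(\<Sum>j=1..n. r k j * a m j) - g m \<le> (\<Sum>l\<le>n. w k l * q m l) - q (Suc m) k" for m
  proof -
    have "pos_tuple n (\<lambda>j. mean_iteration n M A m ((k + j) mod (n + 1)))"
      using iteration_positive[where A = A, OF A mod] by (simp add: pos_tuple_def)
    from operator_mean_vector_state[OF mean[OF k] this x]
    have "q (Suc m) k \<le> g m" by (simp add: g_def a_def q_def)
    then show ?thesis unfolding asum by simp
  qed
  have ge: "0 \<le> (\<Sum>j=1..n. r k j * a m j) - g m" for m
    unfolding g_def
    using affinely_dominated_scalar[where a = "a m" and x = x, OF dom[OF k] a0 x] by simp
  have gap: "(\<lambda>m. (\<Sum>j=1..n. r k j * a m j) - g m) \<longlonglongrightarrow> 0"
    by (rule tendsto_sandwich[OF _ _ tendsto_const dominated_gap_tendsto_0[where q = q, OF p q0 qdom k]])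
      (simp_all only: le ge eventually_True)
  have inv: "a m ((l + (n + 1) - k) mod (n + 1)) = q m l" if "l \<in> {..n} - {k}" for m l
    unfolding a_def cyclic_shift(4)[OF k that] ..
  have "(\<lambda>m. a m ((i + (n + 1) - k) mod (n + 1)) - a m ((j + (n + 1) - k) mod (n + 1))) \<longlonglongrightarrow> 0"
  proof (rule strictly_concave_consensus[where a = a and C = C and x = x,
        OF mean[OF k] dom[OF k] _ x _ _ _ cyclic_shift(3)[OF k ij(1)] cyclic_shift(3)[OF k ij(2)]])
    show "\<forall>i\<in>{1..n}. \<forall>j\<in>{1..n}. b i = b j"
      if "\<And>j. j \<in> {1..n} \<Longrightarrow> 0 \<le> b j"
        "M k (\<lambda>j. b j *\<^sub>R id_blinfun) = (\<Sum>j=1..n. r k j * b j) *\<^sub>R id_blinfun" for b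
      using that by (rule strict)
    show "(\<lambda>m. (\<Sum>j=1..n. r k j * a m j)
        - inner (blinfun_apply (M k (\<lambda>j. a m j *\<^sub>R id_blinfun)) x) x) \<longlonglongrightarrow> 0"
      using gap unfolding g_def .
  qed (rule a0 aC)+
  then show ?thesis unfolding inv[OF ij(1)] inv[OF ij(2)] by (simp add: q_def)
qed

lemma strict_consensus:
  assumes p: "stationary p" "\<And>k. k \<le> n \<Longrightarrow> 0 < p k"
    and k: "k \<le> n" and strict: "\<And>a :: nat \<Rightarrow> real. (\<And>j. j \<in> {1..n} \<Longrightarrow> 0 \<le> a j) \<Longrightarrow>
      M k (\<lambda>j. a j *\<^sub>R id_blinfun) = (\<Sum>j=1..n. r k j * a j) *\<^sub>R id_blinfun \<Longrightarrow>
      (\<forall>i\<in>{1..n}. \<forall>j\<in>{1..n}. a i = a j)"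
    and A: "\<And>k. k \<le> n \<Longrightarrow> positive_op (A k)"
    and ij: "i \<in> {..n} - {k}" "j \<in> {..n} - {k}"
  shows "(\<lambda>m. inner (blinfun_apply (mean_iteration n M A m i) x) x
    - inner (blinfun_apply (mean_iteration n M A m j) x) x) \<longlonglongrightarrow> 0"
proof (cases "x = 0")
  case False
  then have "norm (sgn x) = 1" by (simp add: norm_sgn)
  from strict_consensus_unit[where A = A, OF p k strict A ij this]
  have "(\<lambda>m. inner (blinfun_apply (mean_iteration n M A m i) (sgn x)) (sgn x)
    - inner (blinfun_apply (mean_iteration n M A m j) (sgn x)) (sgn x)) \<longlonglongrightarrow> 0" .
  from tendsto_mult_right_zero[OF this, of "(norm x)\<^sup>2"]
  have "(\<lambda>m. (norm x)\<^sup>2 * (inner (blinfun_apply (mean_iteration n M A m i) (sgn x)) (sgn x)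
    - inner (blinfun_apply (mean_iteration n M A m j) (sgn x)) (sgn x))) \<longlonglongrightarrow> 0" .
  moreover have "inner (blinfun_apply B x) x = (norm x)\<^sup>2 * inner (blinfun_apply B (sgn x)) (sgn x)" for B :: "'a \<Rightarrow>\<^sub>L 'a"
  proof -
    have "inner (blinfun_apply B (norm x *\<^sub>R sgn x)) (norm x *\<^sub>R sgn x)
        = (norm x)\<^sup>2 * inner (blinfun_apply B (sgn x)) (sgn x)"
      by (simp only: blinfun.scaleR_right inner_scaleR_left inner_scaleR_right power2_eq_square mult.assoc)
    then show ?thesis using False by (simp add: sgn_div_norm)
  qed
  ultimately show ?thesis by (simp add: right_diff_distrib)
qed simp

text \<open>Perturb the identity tuple in every entry but the \<open>l\<close>-th by \<open>1 + t\<close>. Since the slot means lie between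
  weighted harmonic and arithmetic means, the first step of the iteration is differentiable at \<open>t = 0\<close>, and
  the resulting inequality, being valid for both signs of \<open>t\<close>, becomes the \<open>l\<close>-th stationarity equation.\<close>

lemma decreasing_imp_stationary:
  assumes KA: "kubo_ando_correspondence TYPE('a)" and x: "norm (x :: 'a) = 1"
    and p: "\<And>k. k \<le> n \<Longrightarrow> 0 < p k" "(\<Sum>k\<le>n. p k) = 1"
    and dec: "\<And>A. (\<And>k. k \<le> n \<Longrightarrow> positive_op (A k)) \<Longrightarrow>
      (\<Sum>k\<le>n. p k *\<^sub>R mean_iteration n M A (Suc 0) k) \<le>\<^sub>o\<^sub>p (\<Sum>k\<le>n. p k *\<^sub>R A k)"
  shows "stationary p"
  unfolding stationary_def
proof (intro allI impI)
  fix l assume l: "l \<le> n"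
  \<comment> \<open>A lower bound, at the vector \<open>x\<close>, for the change of the weighted
    sum in the first step: harmonic bounds for k \<noteq> l, and for k = l the value on a constant
    tuple, as the l-th mean does not see the l-th entry.\<close>
  define h where "h t = (\<Sum>k\<in>{..n} - {l}. p k / (w k l + (1 - w k l) / (1 + t)))
    + p l * (1 + t) - (p l + (1 - p l) * (1 + t))" for t
  have psum: "(\<Sum>k\<in>{..n} - {l}. p k) = 1 - p l"
    using p(2) l by (simp add: sum_diff1)
  have w01: "0 < w k l" "w k l < 1" if "k \<in> {..n} - {l}" for k
    using offdiag[of k l] that l cyclic_shift(3)[of k n l] dom[of k]
    by (auto simp: w_def affinely_dominated_by_def)
  have h_le: "h t \<le> 0" if t: "\<bar>t\<bar> < 1" for t
  proof -
    have t1: "0 < 1 + t" using t by simp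
    define A where "A k = (if k = l then 1 else 1 + t) *\<^sub>R (id_blinfun :: 'a \<Rightarrow>\<^sub>L 'a)" for k
    have A: "positive_op (A k)" for k
      using t1 by (simp add: A_def positive_op_scaleR positive_op_id)
    have ptA: "pos_tuple n (\<lambda>j. A ((k + j) mod (n + 1)))" for k by (simp add: pos_tuple_def A)
    define v where "v k = inner (blinfun_apply (mean_iteration n M A (Suc 0) k) x) x" for k
    have vk: "1 / (w k l + (1 - w k l) / (1 + t)) \<le> v k" if k: "k \<in> {..n} - {l}" for k
    proof -
      \<comment> \<open>The slot in which the k-th mean reads the l-th sequence.\<close>
      define j0 where "j0 = (l + (n + 1) - k) mod (n + 1)"
      have kn: "k \<le> n" and lk: "l \<in> {..n} - {k}" using k l by auto
      have j0: "j0 \<in> {1..n}" unfolding j0_def by (rule cyclic_shift(3)[OF kn lk])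
      have j: "(k + j) mod (n + 1) = l \<longleftrightarrow> j = j0" if "j \<in> {1..n}" for j
        using cyclic_shift(2)[OF kn that] cyclic_shift(4)[OF kn lk] by (auto simp: j0_def)
      have "M k (\<lambda>j. A ((k + j) mod (n + 1))) = M k (\<lambda>j. (if j = j0 then 1 else 1 + t) *\<^sub>R id_blinfun)"
        by (rule operator_mean_cong[OF mean[OF kn] ptA]) (simp only: A_def j)
      moreover have "w k l = r k j0" using lk by (simp add: w_def j0_def)
      ultimately show ?thesis
        using operator_mean_slot_harmonic[OF KA mean[OF kn] dom[OF kn] j0 x t1] by (simp add: v_def)
    qed
    have vl: "1 + t \<le> v l"
    proof -
      have "M l (\<lambda>j. A ((l + j) mod (n + 1))) = M l (\<lambda>j. (1 + t) *\<^sub>R id_blinfun)"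
        using cyclic_shift(1)[OF l] by (intro operator_mean_cong[OF mean[OF l] ptA]) (auto simp: A_def)
      then show ?thesis
        using op_le_inner[OF operator_mean_const_ge[OF mean[OF l], of "1 + t"], of x] t1 x
        by (simp add: v_def blinfun.scaleR_left norm_1_inner)
    qed
    have split: "(\<Sum>k\<le>n. F k) = F l + (\<Sum>k\<in>{..n} - {l}. F k)" for F :: "nat \<Rightarrow> real"
      using l by (simp add: sum.remove)
    have "(\<Sum>k\<le>n. p k * v k) \<le> (\<Sum>k\<le>n. p k * (if k = l then 1 else 1 + t))"
      using op_le_inner[OF dec[of A, OF A], of x] x
      by (simp add: v_def A_def blinfun.sum_left blinfun.scaleR_left inner_sum_left norm_1_inner
          del: mean_iteration.simps)
    also have "\<dots> = p l + (1 - p l) * (1 + t)"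
      unfolding split psum[symmetric] by (simp add: sum_distrib_right)
    finally have "p l * v l + (\<Sum>k\<in>{..n} - {l}. p k * v k) \<le> p l + (1 - p l) * (1 + t)"
      unfolding split[of "\<lambda>k. p k * v k"] .
    moreover have "p l * (1 + t) \<le> p l * v l"
      using vl p(1)[OF l] by simp
    moreover have "(\<Sum>k\<in>{..n} - {l}. p k / (w k l + (1 - w k l) / (1 + t)))
        \<le> (\<Sum>k\<in>{..n} - {l}. p k * v k)"
    proof (rule sum_mono)
      fix k assume k: "k \<in> {..n} - {l}"
      then show "p k / (w k l + (1 - w k l) / (1 + t)) \<le> p k * v k"
        using mult_left_mono[OF vk[OF k], of "p k"] p(1)[of k] by simp
    qed
    ultimately show ?thesis by (simp add: h_def)
  qed
  have "(h has_real_derivative (\<Sum>k\<in>{..n} - {l}. p k * (1 - w k l)) + p l - (1 - p l)) (at 0)"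
    unfolding h_def
    by (auto intro!: derivative_eq_intros simp: w01 algebra_simps)
  moreover have "h 0 = 0" by (simp add: h_def psum)
  ultimately have "(\<Sum>k\<in>{..n} - {l}. p k * (1 - w k l)) + p l - (1 - p l) = 0"
    using h_le by (intro DERIV_local_max[of h _ 0 1]) auto
  then have "(\<Sum>k\<in>{..n} - {l}. p k * w k l) = p l"
    by (simp add: right_diff_distrib sum_subtractf psum)
  then show "(\<Sum>k\<le>n. p k * w k l) = p l"
    using l diag[OF l] by (simp add: sum.remove)
qed

end

section \<open>Arithmetic weights and conclusion\<close>

text \<open>Testing on tuples with a single nonzero entry gives s_i \<le> r_i, and both families sum
  to 1. The arithmetic weights are thus the dominating ones.\<close>

lemma arithmetic_dominated_weights:
  fixes x :: "'a::chilbert_space"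
  assumes arith: "arithmetic_mean n M" and dom: "affinely_dominated_by n r M" and x: "norm x = 1"
    and A: "pos_tuple n (A :: nat \<Rightarrow> 'a \<Rightarrow>\<^sub>L 'a)"
  shows "M A = (\<Sum>j=1..n. r j *\<^sub>R A j)"
proof -
  obtain s where s: "(\<Sum>j=1..n. s j) = 1" "\<And>A. pos_tuple n A \<Longrightarrow> M A = (\<Sum>j=1..n. s j *\<^sub>R A j)"
    using arith by (auto simp: arithmetic_mean_def)
  have le: "s i \<le> r i" if i: "i \<in> {1..n}" for i
  proof -
    let ?a = "\<lambda>j. if j = i then 1 else 0 :: real"
    have eq: "M (\<lambda>j. ?a j *\<^sub>R id_blinfun) = (\<Sum>j=1..n. s j *\<^sub>R ?a j *\<^sub>R id_blinfun)"
      by (intro s(2) pos_tuple_scalar) simp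
    have "inner (blinfun_apply (M (\<lambda>j. ?a j *\<^sub>R id_blinfun)) x) x = (\<Sum>j=1..n. s j * ?a j)"
      unfolding eq using x
      by (simp add: blinfun.sum_left blinfun.scaleR_left inner_sum_left norm_1_inner del: scaleR_scaleR)
    also have "\<dots> = s i" using i by (simp add: if_distrib cong: if_cong)
    finally have "inner (blinfun_apply (M (\<lambda>j. ?a j *\<^sub>R id_blinfun)) x) x = s i" .
    then show ?thesis
      using affinely_dominated_scalar[OF dom _ x, of ?a] i by (simp add: if_distrib cong: if_cong)
  qed
  have "(\<Sum>j=1..n. r j - s j) = 0"
    using s(1) dom by (simp add: sum_subtractf affinely_dominated_by_def)
  then have "r j = s j" if "j \<in> {1..n}" for j
    using le that by (subst (asm) sum_nonneg_eq_0_iff) auto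
  then show ?thesis unfolding s(2)[OF A] by (intro sum.cong) auto
qed

theorem theorem5p1:
  fixes n :: nat
    and M :: "nat \<Rightarrow> (nat \<Rightarrow> 'a::chilbert_space \<Rightarrow>\<^sub>L 'a) \<Rightarrow> 'a \<Rightarrow>\<^sub>L 'a"
  assumes "kubo_ando_correspondence TYPE('a)"
    and "n \<ge> 2"
    and "\<And>k. k \<le> n \<Longrightarrow> operator_mean n (M k)"
    and "\<And>k. k \<le> n \<Longrightarrow> \<not> trivial_mean n (M k)"
    and "\<And>k. k \<le> n \<Longrightarrow> affinely_dominated n (M k)"
    and "(\<forall>k\<le>n. arithmetic_mean n (M k)) \<or> card {k. k \<le> n \<and> \<not> strictly_concave n (M k)} \<le> 1"
  shows "\<exists>!p :: nat \<Rightarrow> real. p \<in> {0..n} \<rightarrow>\<^sub>E {0<..<1} \<and> (\<Sum>k=0..n. p k) = 1 \<and>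
    (\<forall>A :: nat \<Rightarrow> 'a \<Rightarrow>\<^sub>L 'a. (\<forall>k\<le>n. positive_op (A k)) \<longrightarrow>
      (\<exists>S\<in>bounded_operators.
         (\<forall>k\<le>n. wot_tendsto (\<lambda>m. mean_iteration n M A m k) S) \<and>
         (\<lambda>m. \<Sum>k=0..n. p k *\<^sub>R mean_iteration n M A m k) \<down>\<^sub>o\<^sub>p S))"
proof -
  \<comment> \<open>Non-triviality of \<open>M 0\<close> excludes the zero space, on which all
    operators coincide.\<close>
  obtain x :: 'a where x: "norm x = 1"
  proof (cases "\<exists>x::'a. x \<noteq> 0")
    case True
    then show ?thesis using that by (metis norm_sgn)
  next
    case False
    then have "A = B" for A B :: "'a \<Rightarrow>\<^sub>L 'a"
      by (intro blinfun_eqI) metis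
    then have "trivial_mean n (M 0)"
      using assms(2) by (auto simp: trivial_mean_def intro!: bexI[of _ 1])
    then show ?thesis using assms(4)[of 0] by simp
  qed
  define strict where "strict k r \<longleftrightarrow> (\<forall>a :: nat \<Rightarrow> real. (\<forall>j\<in>{1..n}. 0 \<le> a j) \<longrightarrow>
      M k (\<lambda>j. a j *\<^sub>R id_blinfun) = (\<Sum>j=1..n. r j * a j) *\<^sub>R id_blinfun \<longrightarrow>
      (\<forall>i\<in>{1..n}. \<forall>j\<in>{1..n}. a i = a j))" for k r
  \<comment> \<open>Domination and strict concavity come with separate existential witnesses; for a
    strictly concave mean the weights witnessing strictness are taken.\<close>
  have "\<exists>r. affinely_dominated_by n r (M k) \<and> (strictly_concave n (M k) \<longrightarrow> strict k r)" if "k \<le> n" for k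
    using assms(5)[OF that] unfolding affinely_dominated_def strictly_concave_def strict_def by blast
  then obtain r where r: "\<And>k. k \<le> n \<Longrightarrow> affinely_dominated_by n (r k) (M k)"
    and strict: "\<And>k. k \<le> n \<Longrightarrow> strictly_concave n (M k) \<Longrightarrow> strict k (r k)" by metis
  interpret cyclic_means n M r
    by unfold_locales (use assms(2,3) r in auto)
  obtain p where p: "stationary p" "\<And>k. k \<le> n \<Longrightarrow> 0 < p k" "(\<Sum>k\<le>n. p k) = 1"
    using stationary_exists by blast
  have consensus: "(\<lambda>m. inner (blinfun_apply (mean_iteration n M A m i) y) y
        - inner (blinfun_apply (mean_iteration n M A m j) y) y) \<longlonglongrightarrow> 0"
    if A: "\<And>k. k \<le> n \<Longrightarrow> positive_op (A k)" and ij: "i \<le> n" "j \<le> n" for A y i j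
  proof -
    let ?q = "\<lambda>m l. inner (blinfun_apply (mean_iteration n M A m l) y) y"
    from assms(6) show ?thesis
    proof
      assume "\<forall>k\<le>n. arithmetic_mean n (M k)"
      then show ?thesis
        using arithmetic_dominated_weights[OF _ r x]
        by (intro arithmetic_consensus[OF p(1,2) _ A ij]) auto
    next
      assume card: "card {k. k \<le> n \<and> \<not> strictly_concave n (M k)} \<le> 1"
      have str: "(\<lambda>m. ?q m i - ?q m j) \<longlonglongrightarrow> 0"
        if "k \<le> n" "strictly_concave n (M k)" "i \<in> {..n} - {k}" "j \<in> {..n} - {k}" for k i j
        using strict[OF that(1,2)] that(1,3,4) unfolding strict_def
        by (intro strict_consensus[OF p(1,2) that(1) _ A]) auto
      obtain e where e: "\<And>k. k \<le> n \<Longrightarrow> k \<noteq> e \<Longrightarrow> strictly_concave n (M k)"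
      proof (cases "\<exists>e\<le>n. \<not> strictly_concave n (M e)")
        case True
        then obtain e where "e \<le> n" "\<not> strictly_concave n (M e)" by blast
        moreover have "\<And>i j. i \<le> n \<Longrightarrow> j \<le> n \<Longrightarrow> \<not> strictly_concave n (M i) \<Longrightarrow>
            \<not> strictly_concave n (M j) \<Longrightarrow> i = j"
          using card by (simp add: card_le_Suc0_iff_eq)
        ultimately show ?thesis using that[of e] by blast
      qed (use that in blast)
      \<comment> \<open>\<open>a\<close> and \<open>b\<close> avoid the possible exception
        \<open>e\<close>; \<open>c\<close> differs from both and may itself be
        \<open>e\<close>.\<close>
      obtain a b c where abc: "a \<le> n" "b \<le> n" "c \<le> n" "a \<noteq> e" "b \<noteq> e" "a \<noteq> b" "c \<noteq> a" "c \<noteq> b"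
      proof -
        have *: "thesis" if "e = 0 \<or> 2 < e"
          using that assms(2) \<open>\<And>c b a. \<lbrakk>a \<le> n; b \<le> n; c \<le> n; a \<noteq> e; b \<noteq> e; a \<noteq> b; c \<noteq> a; c \<noteq> b\<rbrakk> \<Longrightarrow> thesis\<close>[of 1 2 0]
          by auto
        show ?thesis
          using that[of 1 2 0] that[of 0 2 1] that[of 0 1 2] assms(2) * by linarith
      qed
      \<comment> \<open>The a-th mean compares every index other than \<open>a\<close> with
        \<open>c\<close>; the b-th mean takes care of \<open>a\<close>.\<close>
      have pivot: "(\<lambda>m. ?q m l - ?q m c) \<longlonglongrightarrow> 0" if l: "l \<le> n" for l
      proof (cases "l = a")
        case True
        then show ?thesis using str[of b l c] e[of b] abc l by auto
      next
        case False
        then show ?thesis using str[of a l c] e[of a] abc l by auto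
      qed
      show ?thesis
        using tendsto_diff[OF pivot[OF ij(1)] pivot[OF ij(2)]] by simp
    qed
  qed
  have lt1: "p k < 1" if k: "k \<le> n" for k
  proof -
    obtain l where l: "l \<le> n" "l \<noteq> k" using assms(2) by (metis le_trans one_le_numeral zero_le zero_neq_one)
    have "p k + p l = sum p {k, l}" using l by simp
    also have "\<dots> \<le> (\<Sum>k\<le>n. p k)"
      using p(2) k l by (intro sum_mono2) (auto intro: less_imp_le)
    finally show ?thesis using p(2)[OF l(1)] p(3) by simp
  qed
  \<comment> \<open>Fixing the values outside the index range makes uniqueness of the function the
    same as uniqueness of the vector.\<close>
  let ?p = "restrict p {0..n}"
  show ?thesis
  proof (rule ex1I[of _ ?p], intro conjI allI impI)
    show "?p \<in> {0..n} \<rightarrow>\<^sub>E {0<..<1}" using p(2) lt1 by auto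
    show "(\<Sum>k=0..n. ?p k) = 1" using p(3) by (simp add: atMost_atLeast0)
    fix A :: "nat \<Rightarrow> 'a \<Rightarrow>\<^sub>L 'a" assume A: "\<forall>k\<le>n. positive_op (A k)"
    have "(\<Sum>k=0..n. ?p k *\<^sub>R B k) = (\<Sum>k\<le>n. p k *\<^sub>R B k)" for B :: "nat \<Rightarrow> 'a \<Rightarrow>\<^sub>L 'a"
      by (simp add: atMost_atLeast0)
    then show "\<exists>S\<in>bounded_operators. (\<forall>k\<le>n. wot_tendsto (\<lambda>m. mean_iteration n M A m k) S) \<and>
        (\<lambda>m. \<Sum>k=0..n. ?p k *\<^sub>R mean_iteration n M A m k) \<down>\<^sub>o\<^sub>p S"
      using iteration_converges[OF p _ consensus] A by simp
  next
    fix p' :: "nat \<Rightarrow> real"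
    assume p': "p' \<in> {0..n} \<rightarrow>\<^sub>E {0<..<1} \<and> (\<Sum>k=0..n. p' k) = 1 \<and>
      (\<forall>A :: nat \<Rightarrow> 'a \<Rightarrow>\<^sub>L 'a. (\<forall>k\<le>n. positive_op (A k)) \<longrightarrow>
        (\<exists>S\<in>bounded_operators. (\<forall>k\<le>n. wot_tendsto (\<lambda>m. mean_iteration n M A m k) S) \<and>
           (\<lambda>m. \<Sum>k=0..n. p' k *\<^sub>R mean_iteration n M A m k) \<down>\<^sub>o\<^sub>p S))"
    have pos': "0 < p' k" if "k \<le> n" for k
      using p' that by (auto simp: PiE_iff)
    have sum': "(\<Sum>k\<le>n. p' k) = 1" using p' by (simp add: atMost_atLeast0)
    have "stationary p'"
    proof (rule decreasing_imp_stationary[OF assms(1) x pos' sum'])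
      fix A :: "nat \<Rightarrow> 'a \<Rightarrow>\<^sub>L 'a" assume "\<And>k. k \<le> n \<Longrightarrow> positive_op (A k)"
      then obtain S where "(\<lambda>m. \<Sum>k=0..n. p' k *\<^sub>R mean_iteration n M A m k) \<down>\<^sub>o\<^sub>p S"
        using p' by blast
      then have "(\<Sum>k=0..n. p' k *\<^sub>R mean_iteration n M A (Suc 0) k)
          \<le>\<^sub>o\<^sub>p (\<Sum>k=0..n. p' k *\<^sub>R mean_iteration n M A 0 k)"
        unfolding op_decreases_to_def by blast
      then show "(\<Sum>k\<le>n. p' k *\<^sub>R mean_iteration n M A (Suc 0) k) \<le>\<^sub>o\<^sub>p (\<Sum>k\<le>n. p' k *\<^sub>R A k)"
        by (simp add: atMost_atLeast0)
    qed
    then have "p' k = p k" if "k \<le> n" for k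
      by (rule stationary_unique[where p = p' and q = p, OF _ pos' sum' p that])
    then show "p' = ?p" using p' by (intro extensionalityI[of _ "{0..n}"]) (auto simp: PiE_iff)
  qed
qed

end
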